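(* Let $M$ be a finite monoid and $K$ a field of characteristic $p\ge 0$. Let $e_1,\dots,e_k$ be representatives of the $\mathcal{D}$-classes of idempotents of $M$. Then a function $f\in K^{M/{\equiv}}$ is a virtual character of $M$ over $K$ if and only if $f|_{G_{e_i}}$ is a virtual character of $G_{e_i}$ over $K$ for $i=1,\dots,k$. Moreover, there is a ring isomorphism $$\Phi\colon \mathrm{Ch}_K(M)\longrightarrow \prod_{i=1}^k \mathrm{Ch}_K(G_{e_i})$$ given by $\Phi(f)=(f|_{G_{e_1}},\dots,f|_{G_{e_k}})$ for $f\in \mathrm{Ch}_K(M)$.
   Context: Representations and characters. A representation of a monoid $M$ over $K$ is a monoid homomorphism $\varphi\colon M\to M_r(K)$ with $r\ge 1$; it is irreducible if $K^r$ has no proper nonzero subspace invariant under all $\varphi(m)$. Its character is $\chi_\varphi\colon M\to K$, $\chi_\varphi(m)=\mathrm{Tr}(\varphi(m))$; an irreducible character is the character of an irreducible representation. Idempotents. For an idempotent $e\in M$ ($e^2=e$), $eMe$ is a monoid with identity $e$, and $G_e$ denotes its group of invertible elements (the maximal subgroup of $M$ at $e$). Idempotents $e,f$ are $\mathcal{D}$-equivalent if there exist $x,y\in M$ with $xyx=x$, $yxy=y$, $xy=e$, $yx=f$. Powers and $p$-regularity. For $m\in M$, let $r,s>0$ be minimal with $m^r=m^{r+s}$; then $\{m^r,\dots,m^{r+s-1}\}$ is a cyclic group, with identity denoted $m^\omega$ (the unique idempotent positive power of $m$), generated by $m^{\omega+1}:=m^\omega m$. An element $m$ is a group element if $m=m^{s+1}$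 for some $s>0$; its order $|m|$ is the least such $s$. It is $p$-regular if it is a group element and either $p=0$ or $p\nmid|m|$. For an element $g$ of a finite group, if $p>0$ then $g=g_pg_{p'}=g_{p'}g_p$ is the unique commuting factorization with $g_p$ of $p$-power order and $g_{p'}$ of order prime to $p$; if $p=0$, $g_{p'}=g$. Write $m^{\omega+1}_{p'}=(m^{\omega+1})_{p'}$, computed in the cyclic group generated by $m^{\omega+1}$. The relation $\equiv$. Let $n$ be the least common multiple of the orders of the $p$-regular elements of $M$, $\xi_n$ a primitive $n$-th root of unity in an algebraic closure of $K$, and $T\le\mathbb{Z}_n^*$ the set of $\ell$ such that $\sigma(\xi_n)=\xi_n^\ell$ for some $\sigma\in\mathrm{Gal}(K(\xi_n)/K)$. Then $\equiv$ is the least equivalence relation on $M$ such that $m_1m_2\equiv m_2m_1$ for all $m_1,m_2\in M$; $m\equiv m^{\omega+1}_{p'}$ for all $m\in M$; and $m\equiv m^j$ for all $p$-regular $m\in M$ and $j\in T$. (It coincides with character equivalence: $a\equiv b$ iff $\chi(a)=\chi(b)$ for all characters $\chi$ of $M$ over $K$.) $K^{M/{\equiv}}$ is the ring, under pointwise operations, of functions $f\colon M\to K$ constant on $\equiv$-classes. Virtual characters. A virtual character of a finite monoid (in particular, of a finite group) over $K$ is a $K$-valued function that is a $\mathbb{Z}$-linear combination of irreducible characters over $K$, equivalently a difference of two characters. $\mathrm{Ch}_K(M)$ denotes the ring of virtual characters of $M$ over $K$ under pointwise addition and multiplication. *)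

theory Defs
  imports
    "HOL-Algebra.Algebraic_Closure_Type"
    "HOL-Algebra.Chinese_Remainder"
    "HOL-Algebra.Generated_Fields"
    "HOL-Algebra.Multiplicative_Group"
    "HOL-Number_Theory.Totient"
    "Jordan_Normal_Form.VS_Connect"
begin

definition mat_trace :: "'k::comm_monoid_add mat \<Rightarrow> 'k" where
  "mat_trace A = (\<Sum>i<dim_row A. A $$ (i, i))"

definition monoid_representation ::
    "('a, 'b) monoid_scheme \<Rightarrow> nat \<Rightarrow> ('a \<Rightarrow> 'k::field mat) \<Rightarrow> bool" where
  "monoid_representation M r \<phi> \<longleftrightarrow>
     1 \<le> r \<and>
     \<phi> \<in> carrier M \<rightarrow> carrier_mat r r \<and>
     \<phi> \<one>\<^bsub>M\<^esub> = 1\<^sub>m r \<and>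
     (\<forall>x\<in>carrier M. \<forall>y\<in>carrier M. \<phi> (x \<otimes>\<^bsub>M\<^esub> y) = \<phi> x * \<phi> y)"

text \<open>Here \<open>class_ring\<close> is the field \<open>'k\<close> and \<open>module_vec TYPE('k) r\<close> the space of column vectors
  of length \<open>r\<close>, on which the matrices act.\<close>

definition irreducible_representation ::
    "('a, 'b) monoid_scheme \<Rightarrow> nat \<Rightarrow> ('a \<Rightarrow> 'k::field mat) \<Rightarrow> bool" where
  "irreducible_representation M r \<phi> \<longleftrightarrow>
     monoid_representation M r \<phi> \<and>
     (\<forall>W. VectorSpace.subspace class_ring W (module_vec TYPE('k) r) \<longrightarrow>
          (\<forall>m\<in>carrier M. \<forall>w\<in>W. \<phi> m *\<^sub>v w \<in> W) \<longrightarrow>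
          W = {0\<^sub>v r} \<or> W = carrier_vec r)"

text \<open>Functions on a monoid are represented extensionally: they are \<open>undefined\<close> off the
  carrier, so that they are equal iff they agree on the carrier.\<close>

definition character_of ::
    "('a, 'b) monoid_scheme \<Rightarrow> ('a \<Rightarrow> 'k::field mat) \<Rightarrow> 'a \<Rightarrow> 'k" where
  "character_of M \<phi> = (\<lambda>m\<in>carrier M. mat_trace (\<phi> m))"

definition irreducible_characters ::
    "('a, 'b) monoid_scheme \<Rightarrow> ('a \<Rightarrow> 'k::field) set" where
  "irreducible_characters M =
     {character_of M \<phi> | r \<phi>. irreducible_representation M r \<phi>}"

definition virtual_character ::
    "('a, 'b) monoid_scheme \<Rightarrow> ('a \<Rightarrow> 'k::field) \<Rightarrow> bool" where
  "virtual_character M f \<longleftrightarrow>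
     (\<exists>A (c :: ('a \<Rightarrow> 'k) \<Rightarrow> int). finite A \<and> A \<subseteq> irreducible_characters M \<and>
        f = (\<lambda>m\<in>carrier M. \<Sum>\<chi>\<in>A. of_int (c \<chi>) * \<chi> m))"

definition virtual_character_ring ::
    "('a, 'b) monoid_scheme \<Rightarrow> ('a \<Rightarrow> 'k::field) ring" where
  "virtual_character_ring M =
     \<lparr>carrier = {f. virtual_character M f},
      Group.monoid.mult = (\<lambda>f g. \<lambda>m\<in>carrier M. f m * g m),
      one = (\<lambda>m\<in>carrier M. 1),
      Ring.ring.zero = (\<lambda>m\<in>carrier M. 0),
      Ring.ring.add = (\<lambda>f g. \<lambda>m\<in>carrier M. f m + g m)\<rparr>"

definition idempotents :: "('a, 'b) monoid_scheme \<Rightarrow> 'a set" where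
  "idempotents M = {e \<in> carrier M. e \<otimes>\<^bsub>M\<^esub> e = e}"

definition local_monoid :: "('a, 'b) monoid_scheme \<Rightarrow> 'a \<Rightarrow> ('a, 'b) monoid_scheme" where
  "local_monoid M e =
     M\<lparr>carrier := {e \<otimes>\<^bsub>M\<^esub> m \<otimes>\<^bsub>M\<^esub> e | m. m \<in> carrier M}, one := e\<rparr>"

definition maximal_subgroup :: "('a, 'b) monoid_scheme \<Rightarrow> 'a \<Rightarrow> 'a monoid" where
  "maximal_subgroup M e = units_of (local_monoid M e)"

definition D_equivalent :: "('a, 'b) monoid_scheme \<Rightarrow> 'a \<Rightarrow> 'a \<Rightarrow> bool" where
  "D_equivalent M e f \<longleftrightarrow>
     (\<exists>x\<in>carrier M. \<exists>y\<in>carrier M.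
        x \<otimes>\<^bsub>M\<^esub> y \<otimes>\<^bsub>M\<^esub> x = x \<and> y \<otimes>\<^bsub>M\<^esub> x \<otimes>\<^bsub>M\<^esub> y = y \<and>
        x \<otimes>\<^bsub>M\<^esub> y = e \<and> y \<otimes>\<^bsub>M\<^esub> x = f)"

text \<open>Uniqueness is over list positions, so the representatives are also distinct.\<close>

definition D_class_representatives :: "('a, 'b) monoid_scheme \<Rightarrow> 'a list \<Rightarrow> bool" where
  "D_class_representatives M es \<longleftrightarrow>
     set es \<subseteq> idempotents M \<and>
     (\<forall>f\<in>idempotents M. \<exists>!i. i < length es \<and> D_equivalent M (es ! i) f)"

definition omega_power :: "('a, 'b) monoid_scheme \<Rightarrow> 'a \<Rightarrow> 'a" where
  "omega_power M m =
     (THE e. e \<in> idempotents M \<and> (\<exists>k::nat. 0 < k \<and> e = m [^]\<^bsub>M\<^esub> k))"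

definition omega_succ :: "('a, 'b) monoid_scheme \<Rightarrow> 'a \<Rightarrow> 'a" where
  "omega_succ M m = omega_power M m \<otimes>\<^bsub>M\<^esub> m"

definition group_element :: "('a, 'b) monoid_scheme \<Rightarrow> 'a \<Rightarrow> bool" where
  "group_element M m \<longleftrightarrow> m \<in> carrier M \<and> (\<exists>s::nat. 0 < s \<and> m = m [^]\<^bsub>M\<^esub> (s + 1))"

definition element_order :: "('a, 'b) monoid_scheme \<Rightarrow> 'a \<Rightarrow> nat" where
  "element_order M m = (LEAST s. 0 < s \<and> m = m [^]\<^bsub>M\<^esub> (s + 1))"

definition p_regular :: "('a, 'b) monoid_scheme \<Rightarrow> nat \<Rightarrow> 'a \<Rightarrow> bool" where
  "p_regular M p m \<longleftrightarrow> group_element M m \<and> (p = 0 \<or> \<not> p dvd element_order M m)"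

definition p_prime_part :: "('a, 'b) monoid_scheme \<Rightarrow> nat \<Rightarrow> 'a \<Rightarrow> 'a" where
  "p_prime_part G p g =
     (if p = 0 then g
      else (THE h. h \<in> carrier G \<and>
              (\<exists>u\<in>carrier G. g = u \<otimes>\<^bsub>G\<^esub> h \<and> u \<otimes>\<^bsub>G\<^esub> h = h \<otimes>\<^bsub>G\<^esub> u \<and>
                 (\<exists>k. group.ord G u = p ^ k) \<and> coprime (group.ord G h) p)))"

definition omega_cyclic_group :: "('a, 'b) monoid_scheme \<Rightarrow> 'a \<Rightarrow> 'a monoid" where
  "omega_cyclic_group M m =
     subgroup_generated (maximal_subgroup M (omega_power M m)) {omega_succ M m}"

definition omega_succ_p_prime :: "('a, 'b) monoid_scheme \<Rightarrow> nat \<Rightarrow> 'a \<Rightarrow> 'a" where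
  "omega_succ_p_prime M p m = p_prime_part (omega_cyclic_group M m) p (omega_succ M m)"

definition regular_exponent :: "('a, 'b) monoid_scheme \<Rightarrow> nat \<Rightarrow> nat" where
  "regular_exponent M p = Lcm (element_order M ` {m. p_regular M p m})"

definition primitive_root_of_unity :: "nat \<Rightarrow> 'k::field \<Rightarrow> bool" where
  "primitive_root_of_unity n \<xi> \<longleftrightarrow> 0 < n \<and> \<xi> ^ n = 1 \<and> (\<forall>j. 0 < j \<and> j < n \<longrightarrow> \<xi> ^ j \<noteq> 1)"

definition adjoin :: "'k::field alg_closure \<Rightarrow> 'k alg_closure ring" where
  "adjoin \<xi> =
     (ring_of_type_algebra :: 'k alg_closure ring)
       \<lparr>carrier := generate_field ring_of_type_algebra (insert \<xi> (range to_ac))\<rparr>"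

text \<open>An element of the Galois group over \<open>range to_ac\<close> is only constrained on the carrier of \<open>adjoin \<xi>\<close>.\<close>

definition galois_group :: "'k::field alg_closure \<Rightarrow> ('k alg_closure \<Rightarrow> 'k alg_closure) set" where
  "galois_group \<xi> =
     {\<sigma> \<in> ring_iso (adjoin \<xi>) (adjoin \<xi>). \<forall>a. \<sigma> (to_ac a) = to_ac a}"

text \<open>Units modulo \<open>n\<close> are represented by \<open>totatives n \<subseteq> {1..n}\<close>. The representatives are positive
  also for \<open>n = 1\<close>, where using the exponent \<open>0\<close> below would identify every idempotent with the
  identity.\<close>

definition galois_exponents :: "nat \<Rightarrow> 'k::field alg_closure \<Rightarrow> nat set" where
  "galois_exponents n \<xi> = {l \<in> totatives n. \<exists>\<sigma>\<in>galois_group \<xi>. \<sigma> \<xi> = \<xi> ^ l}"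

inductive char_equiv ::
    "('a, 'b) monoid_scheme \<Rightarrow> nat \<Rightarrow> 'k::field alg_closure \<Rightarrow> 'a \<Rightarrow> 'a \<Rightarrow> bool"
  for M p \<xi> where
  refl: "m \<in> carrier M \<Longrightarrow> char_equiv M p \<xi> m m"
| sym: "char_equiv M p \<xi> m m' \<Longrightarrow> char_equiv M p \<xi> m' m"
| trans: "char_equiv M p \<xi> m m' \<Longrightarrow> char_equiv M p \<xi> m' m'' \<Longrightarrow> char_equiv M p \<xi> m m''"
| swap: "m1 \<in> carrier M \<Longrightarrow> m2 \<in> carrier M \<Longrightarrow>
    char_equiv M p \<xi> (m1 \<otimes>\<^bsub>M\<^esub> m2) (m2 \<otimes>\<^bsub>M\<^esub> m1)"
| p_prime: "m \<in> carrier M \<Longrightarrow> char_equiv M p \<xi> m (omega_succ_p_prime M p m)"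
| galois: "p_regular M p m \<Longrightarrow> j \<in> galois_exponents (regular_exponent M p) \<xi> \<Longrightarrow>
    char_equiv M p \<xi> m (m [^]\<^bsub>M\<^esub> j)"

text \<open>The functions on \<open>M/\<equiv>\<close>, as functions on \<open>M\<close>.\<close>

definition class_functions ::
    "('a, 'b) monoid_scheme \<Rightarrow> nat \<Rightarrow> 'k::field alg_closure \<Rightarrow> ('a \<Rightarrow> 'k) set" where
  "class_functions M p \<xi> =
     {f \<in> carrier M \<rightarrow>\<^sub>E UNIV. \<forall>a b. char_equiv M p \<xi> a b \<longrightarrow> f a = f b}"

definition restrict_to_subgroup ::
    "('a, 'b) monoid_scheme \<Rightarrow> 'a \<Rightarrow> ('a \<Rightarrow> 'k) \<Rightarrow> 'a \<Rightarrow> 'k" where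
  "restrict_to_subgroup M e f = restrict f (carrier (maximal_subgroup M e))"

end

theory Submission
  imports Defs
begin

text \<open>The characters of \<open>M\<close> satisfy \<open>\<chi>(ab) = \<chi>(ba)\<close> and \<open>\<chi>(m) = \<chi>(m\<^sup>\<omega>\<^sup>+\<^sup>1)\<close>, and so do the functions in
  \<open>K\<^sup>M\<^sup>/\<^sup>\<equiv>\<close>. Since \<open>m\<^sup>\<omega>\<^sup>+\<^sup>1\<close> lies in a maximal subgroup and \<open>D\<close>-equivalent idempotents have conjugate
  maximal subgroups, such functions are determined by their restrictions to the \<open>G\<^sub>e\<close> with \<open>e\<close> a chosen
  representative. Hence everything reduces to showing that all families of virtual characters of
  these groups arise by restriction. A representation of \<open>G\<^sub>e\<close> with character \<open>\<chi>\<close> induces, by means of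
  the \<open>L\<close>-class of \<open>e\<close>, a representation of \<open>M\<close> whose character is \<open>\<chi>\<close> on \<open>G\<^sub>e\<close> and vanishes at every
  \<open>m\<close> with \<open>e \<notin> MmM\<close>. So restriction is unitriangular with respect to the order of the ideals \<open>MeM\<close>,
  and a preimage is found by correcting one idempotent at a time in order of increasing ideals.\<close>

section \<open>Splitting off an invariant subspace\<close>

text \<open>Positive characteristic causes two difficulties. Representations need not be completely
  reducible, so they are decomposed only at the level of traces: an invariant subspace makes all
  matrices block triangular, and the diagonal blocks carry the trace. Moreover \<open>p\<close>
  times a character is the zero function, so the coefficients of a virtual character are not
  determined by it. Constructions such as induction are therefore existence statements about
  functions, extended from irreducible characters by adding or subtracting one at a time.
  Restriction to a maximal subgroup has an obstacle of its own: the inclusion sends the unit to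
  \<open>e\<close>, which may act as a proper projection. The repair needs the trace of this
  projection to be an integer in the field. That is read off from the submonoid of powers of one
  element: on each irreducible representation of it, an idempotent positive power acts as 0 or 1.
  The same dichotomy shows that characters do not distinguish an element from its
  \<open>omega_succ\<close>.\<close>

lemma subspace_vec_iff:
  "VectorSpace.subspace class_ring W (module_vec TYPE('k::field) n) \<longleftrightarrow>
     W \<subseteq> carrier_vec n \<and> 0\<^sub>v n \<in> W \<and> (\<forall>v\<in>W. \<forall>w\<in>W. v + w \<in> W) \<and> (\<forall>c. \<forall>v\<in>W. c \<cdot>\<^sub>v v \<in> W)"
  using vec_vs[where ?'a='k, of n] vec_module[where ?'a='k, of n]
  by (auto simp: subspace_def submodule_def module_vec_simps)

text \<open>Applied with \<open>B = 0\<close>, where it makes the kernel of \<open>A\<close>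
  available as a candidate for irreducibility.\<close>

lemma subspace_equalizer:
  fixes A B :: "'k::field mat"
  assumes "A \<in> carrier_mat n n" "B \<in> carrier_mat n n"
  shows "VectorSpace.subspace class_ring {v \<in> carrier_vec n. A *\<^sub>v v = B *\<^sub>v v} (module_vec TYPE('k) n)"
  using assms unfolding subspace_vec_iff
  by (auto simp: mult_add_distrib_mat_vec[of _ n n] mult_mat_vec[of _ n n])

text \<open>The columns of \<open>P\<close> are a basis of the whole space whose first \<open>d\<close> members span \<open>W\<close>.\<close>

lemma subspace_adapted_basis:
  fixes W :: "'k::field vec set"
  assumes W: "VectorSpace.subspace class_ring W (module_vec TYPE('k) n)"
  obtains d P Q where "P \<in> carrier_mat n n" "Q \<in> carrier_mat n n" "P * Q = 1\<^sub>m n" "Q * P = 1\<^sub>m n"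
    "d \<le> n" "W = {P *\<^sub>v v | v. v \<in> carrier_vec n \<and> (\<forall>i. d \<le> i \<longrightarrow> i < n \<longrightarrow> v $ i = 0)}"
proof -
  interpret vec_space "TYPE('k)" n .
  have Wc: "W \<subseteq> carrier_vec n" and sub: "submodule class_ring W V"
    using W by (auto simp: subspace_def submodule_def module_vec_simps)
  \<comment> \<open>Independent sets have at most \<open>dim\<close> elements, so a maximal one
    inside \<open>W\<close> exists; maximality makes it span \<open>W\<close>.\<close>
  define S where "S A \<longleftrightarrow> A \<subseteq> W \<and> lin_indpt A" for A
  have fin: "finite A \<and> card A \<le> dim" if "S A" for A
    using that Wc li_le_dim[OF fin_dim, of A] by (auto simp: S_def)
  have "lin_indpt {}" by (auto simp: lin_dep_def)
  then have "S {}" by (simp add: S_def)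
  then obtain A where A: "finite A" "maximal A S"
    using maximal_exists[of S dim "{}"] fin by blast
  have AW: "A \<subseteq> W" and li: "lin_indpt A" using A by (auto simp: maximal_def S_def)
  have Ac: "A \<subseteq> carrier_vec n" using AW Wc by auto
  have "W \<subseteq> span A"
  proof
    fix w assume w: "w \<in> W"
    show "w \<in> span A"
    proof (rule ccontr)
      assume nw: "w \<notin> span A"
      then have "w \<notin> A" using in_own_span[of A] Ac by auto
      with nw w li have "lin_indpt (A \<union> {w})"
        using lin_dep_iff_in_span[of A w] Ac Wc by auto
      then have "S (A \<union> {w})" using w AW by (auto simp: S_def)
      then have "A \<union> {w} = A" using A(2) unfolding maximal_def by blast
      with \<open>w \<notin> A\<close> show False by blast
    qed
  qed
  moreover have "span A \<subseteq> W" by (rule span_is_subset[OF AW sub])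
  ultimately have spanA: "W = span A" by blast
  have "A \<subseteq> span (set (unit_vecs n))" using Ac span_unit_vecs_is_carrier by simp
  \<comment> \<open>Steinitz exchange completes \<open>A\<close> to a generating set with at most
    \<open>n - card A\<close> further vectors. A generating set has at least \<open>n\<close>
    elements, so \<open>A\<close> and \<open>C\<close> together have exactly
    \<open>n\<close>.\<close>
  from replacement[OF A(1) List.finite_set unit_vecs_carrier li this]
  obtain C where C: "finite C" "C \<subseteq> carrier_vec n" "C \<inter> A = {}"
      "int (card C) \<le> int (card (set (unit_vecs n :: 'k vec list))) - int (card A)"
      "span (A \<union> C) = span (set (unit_vecs n))"
    by blast
  have gen: "span (A \<union> C) = carrier_vec n" using C(5) span_unit_vecs_is_carrier by simp
  have "card (set (unit_vecs n :: 'k vec list)) = n" by (simp add: distinct_card unit_vecs_distinct)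
  then have le: "card A + card C \<le> n" using C(4) by linarith
  have cAC: "card (A \<union> C) = card A + card C" using A(1) C by (intro card_Un_disjoint) auto
  have "n \<le> card (A \<union> C)" using gen_ge_dim[of "A \<union> C"] gen A(1) C(1,2) Ac dim_is_n by auto
  with le cAC have card: "card A + card C = n" by simp
  obtain as cs where as: "set as = A" "distinct as" and cs: "set cs = C" "distinct cs"
    using finite_distinct_list A(1) C(1) by metis
  \<comment> \<open>The basis of \<open>W\<close> comes first, so that \<open>W\<close> is described
    by the vanishing of all coordinates from \<open>d\<close> on.\<close>
  define bs where "bs = as @ cs"
  define d where "d = length as"
  have bs: "set bs = A \<union> C" "distinct bs" "length bs = n" "d \<le> n"
    using as cs C(3) card by (auto simp: bs_def d_def distinct_card[symmetric])
  have bsc: "set bs \<subseteq> carrier_vec n" using bs Ac C by auto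
  define P where "P = mat_of_cols n bs"
  have P: "P \<in> carrier_mat n n" using bs(3) mat_of_cols_carrier(1)[of n bs] by (simp add: P_def)
  have dims: "\<forall>w\<in>set bs. dim_vec w = n" using bsc by auto
  have Pmult: "lincomb a (set bs) = P *\<^sub>v vec n (\<lambda>i. a (bs ! i))" for a
    using lincomb_as_lincomb_list_distinct[OF bsc bs(2), of a]
      lincomb_list_as_mat_mult[OF dims, of "\<lambda>i. a (bs ! i)"] bs(3) by (simp add: P_def)
  have lincomb_Un: "lincomb a (A \<union> C) = lincomb a A" if "\<And>x. x \<in> C \<Longrightarrow> a x = 0" for a
  proof (rule eq_vecI)
    show "dim_vec (lincomb a (A \<union> C)) = dim_vec (lincomb a A)"
      using A(1) C Ac by (simp add: lincomb_dim)
    fix i assume "i < dim_vec (lincomb a A)"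
    then have i: "i < n" using A(1) Ac by (simp add: lincomb_dim)
    show "lincomb a (A \<union> C) $ i = lincomb a A $ i"
      using A(1) C Ac that i by (simp add: lincomb_index sum.union_disjoint Int_commute)
  qed
  have surj: "\<exists>v\<in>carrier_vec n. P *\<^sub>v v = w" if "w \<in> carrier_vec n" for w
  proof -
    have "w \<in> span (set bs)" using that gen bs by simp
    then obtain a where "w = lincomb a (set bs)"
      using finite_in_span[OF _ bsc] by (metis List.finite_set)
    then have "P *\<^sub>v vec n (\<lambda>i. a (bs ! i)) = w" using Pmult by simp
    then show ?thesis by (metis vec_carrier)
  qed
  then have "\<forall>i. \<exists>v. v \<in> carrier_vec n \<and> P *\<^sub>v v = unit_vec n i"
    using unit_vec_carrier by blast
  then obtain q where q: "\<And>i. q i \<in> carrier_vec n \<and> P *\<^sub>v q i = unit_vec n i"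
    by metis
  \<comment> \<open>Column \<open>i\<close> solves \<open>P *\<^sub>v q i = unit_vec n i\<close>, so
    \<open>Q\<close> is a right inverse, and for square matrices also a left one.\<close>
  define Q where "Q = mat_of_cols n (map q [0..<n])"
  have Q: "Q \<in> carrier_mat n n"
    using mat_of_cols_carrier(1)[of n "map q [0..<n]"] by (simp add: Q_def)
  have PQ: "P * Q = 1\<^sub>m n"
  proof (rule mat_col_eqI)
    fix j assume "j < dim_col (1\<^sub>m n :: 'k mat)"
    then have j: "j < n" by simp
    have "col Q j = q j" using j q[of j] unfolding Q_def by (subst col_mat_of_cols) auto
    then show "col (P * Q) j = col (1\<^sub>m n) j" using j q[of j] P Q by (simp add: col_mult2[OF P Q j])
  qed (use P Q in auto)
  have QP: "Q * P = 1\<^sub>m n" by (rule mat_mult_left_right_inverse[OF P Q PQ])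
  have WP: "W = {P *\<^sub>v v | v. v \<in> carrier_vec n \<and> (\<forall>i. d \<le> i \<longrightarrow> i < n \<longrightarrow> v $ i = 0)}"
  proof (intro equalityI subsetI)
    fix w assume "w \<in> W"
    then obtain a where a: "w = lincomb a A" 
      using spanA finite_in_span[OF A(1) Ac] by auto
    \<comment> \<open>Extension of the coefficients by 0, so that \<open>w\<close> becomes a
      combination of the whole basis with no share of \<open>C\<close>.\<close>
    define b where "b x = (if x \<in> A then a x else 0)" for x
    have b0: "b x = 0" if "x \<in> C" for x using that C(3) by (auto simp: b_def)
    have "lincomb a A = lincomb b A"
      using Ac by (intro lincomb_cong) (auto simp: b_def)
    then have "w = lincomb b (A \<union> C)"
      using a lincomb_Un[of b] b0 by simp
    then have "w = P *\<^sub>v vec n (\<lambda>i. b (bs ! i))" using Pmult[of b] bs(1) by simp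
    moreover have "b (bs ! i) = 0" if "d \<le> i" "i < n" for i
    proof -
      have "bs ! i \<in> C" using that cs bs(3) by (auto simp: bs_def d_def nth_append)
      then show ?thesis using C(3) by (auto simp: b_def)
    qed
    ultimately show "w \<in> {P *\<^sub>v v | v. v \<in> carrier_vec n \<and> (\<forall>i. d \<le> i \<longrightarrow> i < n \<longrightarrow> v $ i = 0)}"
      by (intro CollectI exI[of _ "vec n (\<lambda>i. b (bs ! i))"]) auto
  next
    fix w assume "w \<in> {P *\<^sub>v v | v. v \<in> carrier_vec n \<and> (\<forall>i. d \<le> i \<longrightarrow> i < n \<longrightarrow> v $ i = 0)}"
    then obtain v :: "'k vec" where v: "v \<in> carrier_vec n" "\<And>i. d \<le> i \<Longrightarrow> i < n \<Longrightarrow> v $ i = 0" "w = P *\<^sub>v v"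
      by blast
    define a where "a x = v $ (inv_into {..<n} ((!) bs) x)" for x
    have inj: "inj_on ((!) bs) {..<n}" using bs(2,3) by (simp add: inj_on_nth)
    have abs: "a (bs ! i) = v $ i" if "i < n" for i
      using inv_into_f_f[OF inj] that by (simp add: a_def)
    have "a x = 0" if x: "x \<in> C" for x
    proof -
      obtain i where "i < length cs" "cs ! i = x" using x cs by (metis in_set_conv_nth)
      then have "bs ! (d + i) = x" "d + i < n" using bs(3) by (auto simp: bs_def d_def)
      then show ?thesis using abs[of "d + i"] v(2)[of "d + i"] by auto
    qed
    then have "lincomb a A = lincomb a (set bs)" using lincomb_Un bs(1) by metis
    moreover have "vec n (\<lambda>i. a (bs ! i)) = v" using v(1) abs by (intro eq_vecI) auto
    ultimately have "w = lincomb a A" using Pmult[of a] v(3) by simp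
    then show "w \<in> W" unfolding spanA span_def using A(1) by auto
  qed
  show thesis using that[OF P Q PQ QP bs(4) WP] .
qed

section \<open>Traces, and representations indexed by arbitrary finite sets\<close>

lemma mat_trace_carrier: "A \<in> carrier_mat n n \<Longrightarrow> mat_trace A = (\<Sum>i<n. A $$ (i, i))"
  by (auto simp: mat_trace_def)

lemma mat_trace_comm:
  fixes A B :: "'k::comm_semiring_0 mat"
  assumes "A \<in> carrier_mat n m" "B \<in> carrier_mat m n"
  shows "mat_trace (A * B) = mat_trace (B * A)"
proof -
  have "mat_trace (A * B) = (\<Sum>i<n. \<Sum>j<m. A $$ (i, j) * B $$ (j, i))"
    using assms by (auto simp: mat_trace_def scalar_prod_def atLeast0LessThan)
  also have "\<dots> = (\<Sum>j<m. \<Sum>i<n. A $$ (i, j) * B $$ (j, i))" by (rule sum.swap)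
  also have "\<dots> = mat_trace (B * A)"
    using assms by (auto simp: mat_trace_def scalar_prod_def atLeast0LessThan mult.commute)
  finally show ?thesis .
qed

text \<open>Matrices as functions on an arbitrary finite index set. Diagonal blocks, tensor products
  and induced representations are naturally indexed by intervals, by pairs, and by pairs with a
  transversal; the numbering needed for \<open>mat\<close> is then done only once.\<close>

definition matrix_action ::
    "('a, 'b) monoid_scheme \<Rightarrow> 'i set \<Rightarrow> ('a \<Rightarrow> 'i \<Rightarrow> 'i \<Rightarrow> 'k::field) \<Rightarrow> bool" where
  "matrix_action M I a \<longleftrightarrow> finite I \<and>
     (\<forall>i\<in>I. \<forall>j\<in>I. a \<one>\<^bsub>M\<^esub> i j = of_bool (i = j)) \<and>
     (\<forall>x\<in>carrier M. \<forall>y\<in>carrier M. \<forall>i\<in>I. \<forall>j\<in>I. a (x \<otimes>\<^bsub>M\<^esub> y) i j = (\<Sum>k\<in>I. a x i k * a y k j))"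

text \<open>Any numbering of the index set serves, since the trace does not depend on it.
  Nonemptiness is there because representations have degree at least 1.\<close>

lemma matrix_action_representation:
  fixes a :: "'a \<Rightarrow> 'i \<Rightarrow> 'i \<Rightarrow> 'k::field"
  assumes a: "matrix_action M I a" and ne: "I \<noteq> {}"
  obtains \<phi> where "monoid_representation M (card I) \<phi>" "\<And>m. mat_trace (\<phi> m) = (\<Sum>i\<in>I. a m i i)"
proof -
  have fin: "finite I" using a by (simp add: matrix_action_def)
  obtain h where h: "bij_betw h {..<card I} I"
    using ex_bij_betw_nat_finite[OF fin] by (auto simp: atLeast0LessThan)
  have hI: "h i \<in> I" if "i < card I" for i using bij_betwE[OF h] that by auto
  have hinj: "h i = h j \<longleftrightarrow> i = j" if "i < card I" "j < card I" for i j
    using h that by (auto simp: bij_betw_def inj_on_def)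
  define \<phi> where "\<phi> m = mat (card I) (card I) (\<lambda>(i, j). a m (h i) (h j))" for m
  have "\<phi> (x \<otimes>\<^bsub>M\<^esub> y) = \<phi> x * \<phi> y" if "x \<in> carrier M" "y \<in> carrier M" for x y
  proof (rule eq_matI)
    fix i j assume "i < dim_row (\<phi> x * \<phi> y)" "j < dim_col (\<phi> x * \<phi> y)"
    then have ij: "i < card I" "j < card I" by (auto simp: \<phi>_def)
    have "(\<phi> x * \<phi> y) $$ (i, j) = (\<Sum>k<card I. a x (h i) (h k) * a y (h k) (h j))"
      using ij by (simp add: \<phi>_def scalar_prod_def atLeast0LessThan)
    also have "\<dots> = (\<Sum>k\<in>I. a x (h i) k * a y k (h j))"
      by (rule sum.reindex_bij_betw[OF h])
    also have "\<dots> = a (x \<otimes>\<^bsub>M\<^esub> y) (h i) (h j)"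
      using a that hI[OF ij(1)] hI[OF ij(2)] by (simp add: matrix_action_def)
    finally show "\<phi> (x \<otimes>\<^bsub>M\<^esub> y) $$ (i, j) = (\<phi> x * \<phi> y) $$ (i, j)"
      using ij by (simp add: \<phi>_def)
  qed (auto simp: \<phi>_def)
  moreover have "\<phi> \<one>\<^bsub>M\<^esub> = 1\<^sub>m (card I)"
    using a by (intro eq_matI) (auto simp: \<phi>_def matrix_action_def hI hinj)
  moreover have "1 \<le> card I" using fin ne by (simp add: Suc_le_eq card_gt_0_iff)
  ultimately have "monoid_representation M (card I) \<phi>"
    by (auto simp: monoid_representation_def \<phi>_def)
  moreover have "mat_trace (\<phi> m) = (\<Sum>i\<in>I. a m i i)" for m
    using sum.reindex_bij_betw[OF h, of "\<lambda>i. a m i i"] by (simp add: mat_trace_def \<phi>_def)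
  ultimately show thesis by (rule that)
qed

lemma representation_matrix_action:
  assumes "monoid_representation M n \<phi>"
  shows "matrix_action M {..<n} (\<lambda>m i j. \<phi> m $$ (i, j))"
  unfolding matrix_action_def
proof (intro conjI ballI)
  fix x y i j assume xy: "x \<in> carrier M" "y \<in> carrier M" and ij: "i \<in> {..<n}" "j \<in> {..<n}"
  have "\<phi> x \<in> carrier_mat n n" "\<phi> y \<in> carrier_mat n n" "\<phi> (x \<otimes>\<^bsub>M\<^esub> y) = \<phi> x * \<phi> y"
    using assms xy by (auto simp: monoid_representation_def)
  then show "\<phi> (x \<otimes>\<^bsub>M\<^esub> y) $$ (i, j) = (\<Sum>k\<in>{..<n}. \<phi> x $$ (i, k) * \<phi> y $$ (k, j))"
    using ij by (auto simp: scalar_prod_def atLeast0LessThan)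
qed (use assms in \<open>auto simp: monoid_representation_def\<close>)

text \<open>In a basis adapted to an invariant subspace all matrices are block upper triangular. The
  diagonal blocks represent \<open>M\<close> on the subspace and on the quotient, and the trace is
  the sum of theirs; no invariant complement is required.\<close>

lemma reducible_representation_split:
  fixes \<phi> :: "'a \<Rightarrow> 'k::field mat"
  assumes M: "monoid M" and rep: "monoid_representation M n \<phi>"
    and red: "\<not> irreducible_representation M n \<phi>"
  obtains d \<phi>1 \<phi>2 where "d < n" "monoid_representation M d \<phi>1" "n - d < n"
    "monoid_representation M (n - d) \<phi>2"
    "\<And>m. m \<in> carrier M \<Longrightarrow> mat_trace (\<phi> m) = mat_trace (\<phi>1 m) + mat_trace (\<phi>2 m)"
proof -
  interpret monoid M by (rule M)
  have \<phi>: "\<phi> m \<in> carrier_mat n n" if "m \<in> carrier M" for m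
    using rep that by (auto simp: monoid_representation_def)
  obtain W where W: "VectorSpace.subspace class_ring W (module_vec TYPE('k) n)"
      and inv: "\<And>m w. m \<in> carrier M \<Longrightarrow> w \<in> W \<Longrightarrow> \<phi> m *\<^sub>v w \<in> W"
      and W0: "W \<noteq> {0\<^sub>v n}" and W1: "W \<noteq> carrier_vec n"
    using rep red by (auto simp: irreducible_representation_def)
  obtain d P Q where P: "P \<in> carrier_mat n n" and Q: "Q \<in> carrier_mat n n"
      and PQ: "P * Q = 1\<^sub>m n" and QP: "Q * P = 1\<^sub>m n" and dn: "d \<le> n"
      and WP: "W = {P *\<^sub>v v | v. v \<in> carrier_vec n \<and> (\<forall>i. d \<le> i \<longrightarrow> i < n \<longrightarrow> v $ i = 0)}"
    by (rule subspace_adapted_basis[OF W])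
  have "d \<noteq> 0"
  proof
    assume "d = 0"
    have "W \<subseteq> {0\<^sub>v n}"
    proof
      fix w assume "w \<in> W"
      then obtain v :: "'k vec" where "v \<in> carrier_vec n" "w = P *\<^sub>v v" "\<forall>i<n. v $ i = 0"
        using WP \<open>d = 0\<close> by auto
      moreover from this have "v = 0\<^sub>v n" by (intro eq_vecI) auto
      ultimately show "w \<in> {0\<^sub>v n}" using P by auto
    qed
    moreover have "0\<^sub>v n \<in> W" using W by (simp add: subspace_vec_iff)
    ultimately show False using W0 by blast
  qed
  moreover have "d \<noteq> n"
  proof
    assume "d = n"
    have "w \<in> W" if w: "w \<in> carrier_vec n" for w
    proof -
      have "w = P *\<^sub>v (Q *\<^sub>v w)"
        using w P Q PQ by (metis assoc_mult_mat_vec one_mult_mat_vec)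
      moreover have "Q *\<^sub>v w \<in> carrier_vec n" using Q w by auto
      ultimately show ?thesis unfolding WP \<open>d = n\<close> by auto
    qed
    moreover have "W \<subseteq> carrier_vec n" using W by (simp add: subspace_vec_iff)
    ultimately show False using W1 by blast
  qed
  ultimately have d: "0 < d" "d < n" using dn by auto
  define a where "a m i j = (Q * \<phi> m * P) $$ (i, j)" for m i j
  have a_one: "a \<one>\<^bsub>M\<^esub> i j = of_bool (i = j)" if "i < n" "j < n" for i j
    using rep Q QP that by (simp add: a_def monoid_representation_def)
  have a_mult: "a (x \<otimes>\<^bsub>M\<^esub> y) i j = (\<Sum>k<n. a x i k * a y k j)"
    if xy: "x \<in> carrier M" "y \<in> carrier M" and ij: "i < n" "j < n" for x y i j
  proof -
    have "(Q * \<phi> x * P) * (Q * \<phi> y * P) = Q * \<phi> x * (P * Q) * \<phi> y * P"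
      using P Q \<phi>[OF xy(1)] \<phi>[OF xy(2)] by (simp add: assoc_mult_mat[of _ n n _ n _ n])
    also have "\<dots> = Q * \<phi> (x \<otimes>\<^bsub>M\<^esub> y) * P"
      using P Q \<phi>[OF xy(1)] \<phi>[OF xy(2)] PQ rep xy
      by (simp add: assoc_mult_mat[of _ n n _ n _ n] monoid_representation_def)
    finally have "a (x \<otimes>\<^bsub>M\<^esub> y) i j = ((Q * \<phi> x * P) * (Q * \<phi> y * P)) $$ (i, j)"
      by (simp add: a_def)
    also have "\<dots> = (\<Sum>k<n. a x i k * a y k j)"
      using P Q \<phi>[OF xy(1)] \<phi>[OF xy(2)] ij
      unfolding a_def by (subst index_mult_mat) (auto simp: scalar_prod_def atLeast0LessThan)
    finally show ?thesis .
  qed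
  \<comment> \<open>Column \<open>j < d\<close> of \<open>P\<close> lies in \<open>W\<close>, and so
    does its image under \<open>\<phi> m\<close>; coordinates from \<open>d\<close> on therefore
    vanish.\<close>
  have a_tri: "a m i j = 0" if m: "m \<in> carrier M" and ij: "d \<le> i" "i < n" "j < d" for m i j
  proof -
    have jn: "j < n" using ij d by simp
    have "col P j = P *\<^sub>v unit_vec n j" using P jn by (intro eq_vecI) auto
    then have "col P j \<in> W" using WP ij jn by auto
    then have "\<phi> m *\<^sub>v col P j \<in> W" using inv m by blast
    then obtain v :: "'k vec" where v: "v \<in> carrier_vec n" "\<phi> m *\<^sub>v col P j = P *\<^sub>v v" "v $ i = 0"
      using WP ij by auto
    have "col (Q * \<phi> m * P) j = Q *\<^sub>v (\<phi> m *\<^sub>v col P j)"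
      unfolding col_mult2[OF mult_carrier_mat[OF Q \<phi>[OF m]] P jn]
      using P jn by (intro assoc_mult_mat_vec[OF Q \<phi>[OF m]]) auto
    also have "\<dots> = v" unfolding v(2) using P Q QP v(1)
      by (metis assoc_mult_mat_vec one_mult_mat_vec)
    finally have "v $ i = a m i j" using P Q \<phi>[OF m] ij jn unfolding a_def by (metis carrier_matD index_col index_mult_mat(2,3))
    then show ?thesis using v(3) by simp
  qed
  have split: "{..<n} = {..<d} \<union> {d..<n}" using d by auto
  have act1: "matrix_action M {..<d} a"
    unfolding matrix_action_def
  proof (intro conjI ballI)
    fix x y i j assume *: "x \<in> carrier M" "y \<in> carrier M" "i \<in> {..<d}" "j \<in> {..<d}"
    have "a (x \<otimes>\<^bsub>M\<^esub> y) i j = (\<Sum>k<n. a x i k * a y k j)" using * d by (intro a_mult) auto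
    also have "\<dots> = (\<Sum>k<d. a x i k * a y k j) + (\<Sum>k=d..<n. a x i k * a y k j)"
      unfolding split by (intro sum.union_disjoint) auto
    \<comment> \<open>Here the factor \<open>a y k j\<close> vanishes, as
      \<open>j < d \<le> k\<close>. In the other block it is \<open>a x i k\<close>, with
      \<open>k < d \<le> i\<close>.\<close>
    also have "(\<Sum>k=d..<n. a x i k * a y k j) = 0" using * a_tri by (intro sum.neutral) auto
    finally show "a (x \<otimes>\<^bsub>M\<^esub> y) i j = (\<Sum>k<d. a x i k * a y k j)" by simp
  qed (use d in \<open>simp_all add: a_one\<close>)
  have "{..<d} \<noteq> {}" using d by auto
  from matrix_action_representation[OF act1 this]
  obtain \<phi>1 where \<phi>1: "monoid_representation M d \<phi>1"
      "\<And>m. mat_trace (\<phi>1 m) = (\<Sum>i<d. a m i i)"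
    unfolding card_lessThan card_atLeastLessThan by blast
  have act2: "matrix_action M {d..<n} a"
    unfolding matrix_action_def
  proof (intro conjI ballI)
    fix x y i j assume *: "x \<in> carrier M" "y \<in> carrier M" "i \<in> {d..<n}" "j \<in> {d..<n}"
    have "a (x \<otimes>\<^bsub>M\<^esub> y) i j = (\<Sum>k<n. a x i k * a y k j)" using * d by (intro a_mult) auto
    also have "\<dots> = (\<Sum>k<d. a x i k * a y k j) + (\<Sum>k=d..<n. a x i k * a y k j)"
      unfolding split by (intro sum.union_disjoint) auto
    also have "(\<Sum>k<d. a x i k * a y k j) = 0" using * a_tri by (intro sum.neutral) auto
    finally show "a (x \<otimes>\<^bsub>M\<^esub> y) i j = (\<Sum>k=d..<n. a x i k * a y k j)" by simp
  qed (use d in \<open>simp_all add: a_one\<close>)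
  have "{d..<n} \<noteq> {}" using d by auto
  from matrix_action_representation[OF act2 this]
  obtain \<phi>2 where \<phi>2: "monoid_representation M (n - d) \<phi>2"
      "\<And>m. mat_trace (\<phi>2 m) = (\<Sum>i=d..<n. a m i i)"
    unfolding card_lessThan card_atLeastLessThan by blast
  have "mat_trace (\<phi> m) = mat_trace (\<phi>1 m) + mat_trace (\<phi>2 m)" if m: "m \<in> carrier M" for m
  proof -
    have "mat_trace (\<phi>1 m) + mat_trace (\<phi>2 m) = (\<Sum>i<n. a m i i)"
      unfolding \<phi>1 \<phi>2 split by (intro sum.union_disjoint[symmetric]) auto
    also have "\<dots> = mat_trace ((Q * \<phi> m) * P)"
      using P Q \<phi>[OF m] by (subst mat_trace_carrier[of _ n]) (auto simp: a_def)
    also have "\<dots> = mat_trace (P * (Q * \<phi> m))"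
      using P Q \<phi>[OF m] by (intro mat_trace_comm) auto
    also have "P * (Q * \<phi> m) = \<phi> m"
      using P Q PQ \<phi>[OF m] by (simp add: assoc_mult_mat[of _ n n _ n _ n, symmetric])
    finally show ?thesis by simp
  qed
  then show thesis using that[of d \<phi>1 \<phi>2] d \<phi>1(1) \<phi>2(1) by auto
qed

section \<open>Virtual characters\<close>

lemma irreducible_character_extensional:
  "\<chi> \<in> irreducible_characters M \<Longrightarrow> (\<lambda>m\<in>carrier M. \<chi> m) = \<chi>"
  by (auto simp: irreducible_characters_def character_of_def)

lemma virtual_character_extensional:
  "virtual_character M f \<Longrightarrow> (\<lambda>m\<in>carrier M. f m) = f"
  by (auto simp: virtual_character_def)

lemma virtual_character_zero: "virtual_character M (\<lambda>m\<in>carrier M. 0)"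
  unfolding virtual_character_def by (intro exI[of _ "{}"]) simp

lemma irreducible_virtual_character:
  "\<chi> \<in> irreducible_characters M \<Longrightarrow> virtual_character M \<chi>"
  unfolding virtual_character_def
  by (intro exI[of _ "{\<chi>}"] exI[of _ "\<lambda>_. 1"]) (simp add: irreducible_character_extensional)

lemma virtual_character_add:
  fixes f g :: "'a \<Rightarrow> 'k::field"
  assumes "virtual_character M f" "virtual_character M g"
  shows "virtual_character M (\<lambda>m\<in>carrier M. f m + g m)"
proof -
  obtain A c where A: "finite A" "A \<subseteq> irreducible_characters M"
      "f = (\<lambda>m\<in>carrier M. \<Sum>\<chi>\<in>A. of_int (c \<chi>) * \<chi> m)"
    using assms(1) unfolding virtual_character_def by blast
  obtain B d where B: "finite B" "B \<subseteq> irreducible_characters M"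
      "g = (\<lambda>m\<in>carrier M. \<Sum>\<chi>\<in>B. of_int (d \<chi>) * \<chi> m)"
    using assms(2) unfolding virtual_character_def by blast
  \<comment> \<open>Both coefficient functions are extended by 0 to the union before they are
    added.\<close>
  define e where "e \<chi> = (if \<chi> \<in> A then c \<chi> else 0) + (if \<chi> \<in> B then d \<chi> else 0)" for \<chi>
  have "(\<Sum>\<chi>\<in>A \<union> B. of_int (e \<chi>) * \<chi> m) =
      (\<Sum>\<chi>\<in>A. of_int (c \<chi>) * \<chi> m) + (\<Sum>\<chi>\<in>B. of_int (d \<chi>) * \<chi> m)" for m
  proof -
    have "(\<Sum>\<chi>\<in>A. of_int (c \<chi>) * \<chi> m) = (\<Sum>\<chi>\<in>A \<union> B. of_int (if \<chi> \<in> A then c \<chi> else 0) * \<chi> m)"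
      using A(1) B(1) by (intro sum.mono_neutral_cong_left) auto
    moreover have "(\<Sum>\<chi>\<in>B. of_int (d \<chi>) * \<chi> m) = (\<Sum>\<chi>\<in>A \<union> B. of_int (if \<chi> \<in> B then d \<chi> else 0) * \<chi> m)"
      using A(1) B(1) by (intro sum.mono_neutral_cong_left) auto
    ultimately show ?thesis by (simp add: e_def sum.distrib distrib_right)
  qed
  then have "(\<lambda>m\<in>carrier M. f m + g m) = (\<lambda>m\<in>carrier M. \<Sum>\<chi>\<in>A \<union> B. of_int (e \<chi>) * \<chi> m)"
    unfolding A(3) B(3) by (intro restrict_ext) simp
  then show ?thesis
    unfolding virtual_character_def using A(1,2) B(1,2)
    by (intro exI[of _ "A \<union> B"] exI[of _ e]) simp
qed

lemma virtual_character_uminus: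
  assumes "virtual_character M f"
  shows "virtual_character M (\<lambda>m\<in>carrier M. - f m)"
proof -
  obtain A c where A: "finite A" "A \<subseteq> irreducible_characters M"
      "f = (\<lambda>m\<in>carrier M. \<Sum>\<chi>\<in>A. of_int (c \<chi>) * \<chi> m)"
    using assms(1) unfolding virtual_character_def by blast
  have eq: "(\<lambda>m\<in>carrier M. - f m) = (\<lambda>m\<in>carrier M. \<Sum>\<chi>\<in>A. of_int (- c \<chi>) * \<chi> m)"
    unfolding A(3)
    by (intro restrict_ext) (simp add: sum_negf)
  show ?thesis
    unfolding virtual_character_def
    by (intro exI[of _ A] exI[of _ "\<lambda>\<chi>. - c \<chi>"] conjI A(1,2) eq)
qed

lemma virtual_character_diff:
  assumes "virtual_character M f" "virtual_character M g"
  shows "virtual_character M (\<lambda>m\<in>carrier M. f m - g m)"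
proof -
  have eq: "(\<lambda>m\<in>carrier M. f m - g m) = (\<lambda>m\<in>carrier M. f m + (\<lambda>m\<in>carrier M. - g m) m)"
    by (intro restrict_ext) simp
  show ?thesis unfolding eq by (rule virtual_character_add[OF assms(1) virtual_character_uminus[OF assms(2)]])
qed

text \<open>Reaches a virtual character from 0 by adding or subtracting one irreducible character at
  a time. This suits additive properties, also existential ones, without a choice of coefficients
  having to be carried along.\<close>

lemma virtual_character_induct [consumes 1, case_names zero add diff]:
  fixes f :: "'a \<Rightarrow> 'k::field"
  assumes f: "virtual_character M f"
    and zero: "P (\<lambda>m\<in>carrier M. 0)"
    and add: "\<And>f \<chi>. virtual_character M f \<Longrightarrow> P f \<Longrightarrow> \<chi> \<in> irreducible_characters M \<Longrightarrow>
      P (\<lambda>m\<in>carrier M. f m + \<chi> m)"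
    and diff: "\<And>f \<chi>. virtual_character M f \<Longrightarrow> P f \<Longrightarrow> \<chi> \<in> irreducible_characters M \<Longrightarrow>
      P (\<lambda>m\<in>carrier M. f m - \<chi> m)"
  shows "P f"
proof -
  obtain A c where A: "finite A" "A \<subseteq> irreducible_characters M"
      "f = (\<lambda>m\<in>carrier M. \<Sum>\<chi>\<in>A. of_int (c \<chi>) * \<chi> m)"
    using f unfolding virtual_character_def by blast
  \<comment> \<open>An integer multiple of one irreducible character is absorbed by integer
    induction in both directions from 0, which is why both \<open>add\<close> and
    \<open>diff\<close> are assumed.\<close>
  have step: "virtual_character M (\<lambda>m\<in>carrier M. g m + of_int n * \<chi> m) \<and>
      P (\<lambda>m\<in>carrier M. g m + of_int n * \<chi> m)"
    if g: "virtual_character M g" "P g" and \<chi>: "\<chi> \<in> irreducible_characters M" for g \<chi> n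
  proof (induction n rule: int_induct[of _ 0])
    case base
    then show ?case using g virtual_character_extensional[OF g(1)] by simp
  next
    case (step1 n)
    let ?g = "\<lambda>m\<in>carrier M. g m + of_int n * \<chi> m"
    have "(\<lambda>m\<in>carrier M. g m + of_int (n + 1) * \<chi> m) = (\<lambda>m\<in>carrier M. ?g m + \<chi> m)"
      by (intro restrict_ext) (simp add: algebra_simps)
    then show ?case
      using step1.IH add[of ?g \<chi>] \<chi> virtual_character_add[of M ?g \<chi>] irreducible_virtual_character
      by metis
  next
    case (step2 n)
    let ?g = "\<lambda>m\<in>carrier M. g m + of_int n * \<chi> m"
    have "(\<lambda>m\<in>carrier M. g m + of_int (n - 1) * \<chi> m) = (\<lambda>m\<in>carrier M. ?g m - \<chi> m)"
      by (intro restrict_ext) (simp add: algebra_simps)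
    then show ?case
      using step2.IH diff[of ?g \<chi>] \<chi> virtual_character_diff[of M ?g \<chi>] irreducible_virtual_character
      by metis
  qed
  have "virtual_character M (\<lambda>m\<in>carrier M. \<Sum>\<chi>\<in>A. of_int (c \<chi>) * \<chi> m) \<and>
      P (\<lambda>m\<in>carrier M. \<Sum>\<chi>\<in>A. of_int (c \<chi>) * \<chi> m)"
    using A(1,2)
  proof (induction A)
    case empty
    then show ?case unfolding sum.empty using zero virtual_character_zero[of M] by blast
  next
    case (insert \<chi> A)
    let ?g = "\<lambda>m\<in>carrier M. \<Sum>\<chi>\<in>A. of_int (c \<chi>) * \<chi> m"
    have IH: "virtual_character M ?g" "P ?g" and \<chi>: "\<chi> \<in> irreducible_characters M"
      using insert by blast+
    have eq: "(\<lambda>m\<in>carrier M. \<Sum>\<chi>\<in>insert \<chi> A. of_int (c \<chi>) * \<chi> m) =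
        (\<lambda>m\<in>carrier M. ?g m + of_int (c \<chi>) * \<chi> m)"
      using insert.hyps by (intro restrict_ext) (simp add: algebra_simps)
    show ?case unfolding eq by (rule step[OF IH \<chi>])
  qed
  then show ?thesis using A(3) by simp
qed

text \<open>Induction on the degree: a reducible representation has the trace of two representations
  of smaller degree. Padded, tensor and induced representations are seldom irreducible, and this
  turns their traces into virtual characters.\<close>

lemma character_of_virtual:
  assumes M: "monoid M" and rep: "monoid_representation M n \<phi>"
  shows "virtual_character M (character_of M \<phi>)"
  using rep
proof (induction n arbitrary: \<phi> rule: less_induct)
  case (less n)
  show ?case
  proof (cases "irreducible_representation M n \<phi>")
    case True
    then show ?thesis
      by (intro irreducible_virtual_character) (auto simp: irreducible_characters_def)
  next
    case False
    obtain d \<phi>1 \<phi>2 where *: "d < n" "monoid_representation M d \<phi>1" "n - d < n"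
        "monoid_representation M (n - d) \<phi>2"
        "\<And>m. m \<in> carrier M \<Longrightarrow> mat_trace (\<phi> m) = mat_trace (\<phi>1 m) + mat_trace (\<phi>2 m)"
      by (rule reducible_representation_split[OF M less.prems False]) (rule that)
    have eq: "character_of M \<phi> = (\<lambda>m\<in>carrier M. character_of M \<phi>1 m + character_of M \<phi>2 m)"
      unfolding character_of_def using *(5) by (intro restrict_ext) simp
    show ?thesis
      unfolding eq by (rule virtual_character_add[OF less.IH[OF *(1,2)] less.IH[OF *(3,4)]])
  qed
qed

lemma irreducible_character_obtain:
  assumes "\<chi> \<in> irreducible_characters M"
  obtains n \<phi> where "irreducible_representation M n \<phi>" "monoid_representation M n \<phi>"
    "\<chi> = character_of M \<phi>"
  using assms by (auto simp: irreducible_characters_def irreducible_representation_def)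

section \<open>Products of virtual characters\<close>

lemma virtual_character_one:
  assumes "monoid M"
  shows "virtual_character M (\<lambda>m\<in>carrier M. 1 :: 'k::field)"
proof -
  have "monoid_representation M 1 (\<lambda>_. 1\<^sub>m 1 :: 'k mat)"
    by (auto simp: monoid_representation_def)
  moreover have "character_of M (\<lambda>_. 1\<^sub>m 1 :: 'k mat) = (\<lambda>m\<in>carrier M. 1)"
    by (auto simp: character_of_def mat_trace_def)
  ultimately show ?thesis using character_of_virtual[OF assms] by metis
qed

text \<open>The Kronecker product, with pairs as indices; multiplicativity is the product of the two
  matrix product sums.\<close>

lemma matrix_action_tensor:
  fixes a :: "'a \<Rightarrow> 'i \<Rightarrow> 'i \<Rightarrow> 'k::field" and b :: "'a \<Rightarrow> 'j \<Rightarrow> 'j \<Rightarrow> 'k"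
  assumes "matrix_action M I a" "matrix_action M J b"
  shows "matrix_action M (I \<times> J) (\<lambda>m p q. a m (fst p) (fst q) * b m (snd p) (snd q))"
  unfolding matrix_action_def
proof (intro conjI ballI)
  show "finite (I \<times> J)" using assms by (auto simp: matrix_action_def)
next
  fix p q assume "p \<in> I \<times> J" "q \<in> I \<times> J"
  then show "a \<one>\<^bsub>M\<^esub> (fst p) (fst q) * b \<one>\<^bsub>M\<^esub> (snd p) (snd q) = of_bool (p = q)"
    using assms by (auto simp: matrix_action_def)
next
  fix x y p q assume *: "x \<in> carrier M" "y \<in> carrier M" "p \<in> I \<times> J" "q \<in> I \<times> J"
  have "a (x \<otimes>\<^bsub>M\<^esub> y) (fst p) (fst q) * b (x \<otimes>\<^bsub>M\<^esub> y) (snd p) (snd q) =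
      (\<Sum>k\<in>I. a x (fst p) k * a y k (fst q)) * (\<Sum>l\<in>J. b x (snd p) l * b y l (snd q))"
    using assms * by (auto simp: matrix_action_def)
  also have "\<dots> = (\<Sum>(k, l)\<in>I \<times> J. (a x (fst p) k * a y k (fst q)) * (b x (snd p) l * b y l (snd q)))"
    by (simp add: sum_product sum.cartesian_product)
  also have "\<dots> = (\<Sum>r\<in>I \<times> J. a x (fst p) (fst r) * b x (snd p) (snd r) *
      (a y (fst r) (fst q) * b y (snd r) (snd q)))"
    by (intro sum.cong) (auto simp: ac_simps)
  finally show "a (x \<otimes>\<^bsub>M\<^esub> y) (fst p) (fst q) * b (x \<otimes>\<^bsub>M\<^esub> y) (snd p) (snd q) = \<dots>" .
qed

lemma irreducible_character_mult:
  fixes \<chi> \<psi> :: "'a \<Rightarrow> 'k::field"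
  assumes M: "monoid M" and \<chi>: "\<chi> \<in> irreducible_characters M" and \<psi>: "\<psi> \<in> irreducible_characters M"
  shows "virtual_character M (\<lambda>m\<in>carrier M. \<chi> m * \<psi> m)"
proof -
  obtain n A where A: "monoid_representation M n A" "\<chi> = character_of M A"
    using irreducible_character_obtain[OF \<chi>] by metis
  obtain k B where B: "monoid_representation M k B" "\<psi> = character_of M B"
    using irreducible_character_obtain[OF \<psi>] by metis
  have "{..<n} \<times> {..<k} \<noteq> {}" using A B by (auto simp: monoid_representation_def lessThan_empty_iff)
  from matrix_action_representation[OF matrix_action_tensor[OF
      representation_matrix_action[OF A(1)] representation_matrix_action[OF B(1)]] this]
  obtain C where C: "monoid_representation M (card ({..<n} \<times> {..<k})) C"
      "\<And>m. mat_trace (C m) = (\<Sum>i\<in>{..<n} \<times> {..<k}. A m $$ (fst i, fst i) * B m $$ (snd i, snd i))"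
    by blast
  have "mat_trace (C m) = mat_trace (A m) * mat_trace (B m)" if "m \<in> carrier M" for m
  proof -
    have "A m \<in> carrier_mat n n" "B m \<in> carrier_mat k k"
      using A(1) B(1) that by (auto simp: monoid_representation_def)
    then show ?thesis
      unfolding C(2) by (simp add: mat_trace_carrier sum_product sum.cartesian_product case_prod_unfold)
  qed
  then have "(\<lambda>m\<in>carrier M. \<chi> m * \<psi> m) = character_of M C"
    unfolding A(2) B(2) character_of_def by (intro restrict_ext) simp
  then show ?thesis using character_of_virtual[OF M C(1)] by simp
qed

text \<open>By bilinearity the claim reduces to two irreducible characters, one factor at a
  time.\<close>

lemma virtual_character_mult:
  fixes f g :: "'a \<Rightarrow> 'k::field"
  assumes M: "monoid M" and f: "virtual_character M f" and g: "virtual_character M g"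
  shows "virtual_character M (\<lambda>m\<in>carrier M. f m * g m)"
proof -
  have irr: "virtual_character M (\<lambda>m\<in>carrier M. h m * \<chi> m)"
    if "virtual_character M h" and \<chi>: "\<chi> \<in> irreducible_characters M" for h \<chi> :: "'a \<Rightarrow> 'k"
    using that(1)
  proof (induction rule: virtual_character_induct)
    case zero
    have eq: "(\<lambda>m\<in>carrier M. (\<lambda>m\<in>carrier M. 0) m * \<chi> m) = (\<lambda>m\<in>carrier M. 0)"
      by (intro restrict_ext) simp
    show ?case unfolding eq by (rule virtual_character_zero[of M])
  next
    case (add h \<psi>)
    have eq: "(\<lambda>m\<in>carrier M. (\<lambda>m\<in>carrier M. h m + \<psi> m) m * \<chi> m) =
        (\<lambda>m\<in>carrier M. (\<lambda>m\<in>carrier M. h m * \<chi> m) m + (\<lambda>m\<in>carrier M. \<psi> m * \<chi> m) m)"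
      by (intro restrict_ext) (simp add: algebra_simps)
    show ?case unfolding eq by (rule virtual_character_add[OF add.IH irreducible_character_mult[OF M \<open>\<psi> \<in> irreducible_characters M\<close> \<chi>]])
  next
    case (diff h \<psi>)
    have eq: "(\<lambda>m\<in>carrier M. (\<lambda>m\<in>carrier M. h m - \<psi> m) m * \<chi> m) =
        (\<lambda>m\<in>carrier M. (\<lambda>m\<in>carrier M. h m * \<chi> m) m - (\<lambda>m\<in>carrier M. \<psi> m * \<chi> m) m)"
      by (intro restrict_ext) (simp add: algebra_simps)
    show ?case unfolding eq by (rule virtual_character_diff[OF diff.IH irreducible_character_mult[OF M \<open>\<psi> \<in> irreducible_characters M\<close> \<chi>]])
  qed
  show ?thesis using g
  proof (induction rule: virtual_character_induct)
    case zero
    have eq: "(\<lambda>m\<in>carrier M. f m * (\<lambda>m\<in>carrier M. 0) m) = (\<lambda>m\<in>carrier M. 0)"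
      by (intro restrict_ext) simp
    show ?case unfolding eq by (rule virtual_character_zero[of M])
  next
    case (add h \<psi>)
    have eq: "(\<lambda>m\<in>carrier M. f m * (\<lambda>m\<in>carrier M. h m + \<psi> m) m) =
        (\<lambda>m\<in>carrier M. (\<lambda>m\<in>carrier M. f m * h m) m + (\<lambda>m\<in>carrier M. f m * \<psi> m) m)"
      by (intro restrict_ext) (simp add: algebra_simps)
    show ?case unfolding eq by (rule virtual_character_add[OF add.IH irr[OF f \<open>\<psi> \<in> irreducible_characters M\<close>]])
  next
    case (diff h \<psi>)
    have eq: "(\<lambda>m\<in>carrier M. f m * (\<lambda>m\<in>carrier M. h m - \<psi> m) m) =
        (\<lambda>m\<in>carrier M. (\<lambda>m\<in>carrier M. f m * h m) m - (\<lambda>m\<in>carrier M. f m * \<psi> m) m)"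
      by (intro restrict_ext) (simp add: algebra_simps)
    show ?case unfolding eq by (rule virtual_character_diff[OF diff.IH irr[OF f \<open>\<psi> \<in> irreducible_characters M\<close>]])
  qed
qed

text \<open>The injectivity half of Schur's lemma: the kernel of \<open>A\<close> is invariant, and
  it is not the whole space because \<open>A\<close> is nonzero.\<close>

lemma irreducible_commuting_injective:
  fixes \<phi> :: "'a \<Rightarrow> 'k::field mat"
  assumes irr: "irreducible_representation M r \<phi>" and A: "A \<in> carrier_mat r r" "A \<noteq> 0\<^sub>m r r"
    and comm: "\<And>m. m \<in> carrier M \<Longrightarrow> \<phi> m * A = A * \<phi> m"
    and v: "v \<in> carrier_vec r" "A *\<^sub>v v = 0\<^sub>v r"
  shows "v = 0\<^sub>v r"
proof -
  let ?W = "{v \<in> carrier_vec r. A *\<^sub>v v = 0\<^sub>m r r *\<^sub>v v}"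
  have \<phi>: "\<phi> m \<in> carrier_mat r r" if "m \<in> carrier M" for m
    using irr that by (auto simp: irreducible_representation_def monoid_representation_def)
  have zero: "0\<^sub>m r r *\<^sub>v w = 0\<^sub>v r" if "w \<in> carrier_vec r" for w :: "'k vec"
    using that by (intro eq_vecI) auto
  have sub: "VectorSpace.subspace class_ring ?W (module_vec TYPE('k) r)"
    using A by (intro subspace_equalizer) auto
  have inv: "\<phi> m *\<^sub>v w \<in> ?W" if m: "m \<in> carrier M" and w: "w \<in> ?W" for m w
  proof -
    have "A *\<^sub>v (\<phi> m *\<^sub>v w) = (\<phi> m * A) *\<^sub>v w"
      using comm[OF m] assoc_mult_mat_vec[OF A(1) \<phi>[OF m], of w] w by simp
    also have "\<dots> = \<phi> m *\<^sub>v 0\<^sub>v r"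
      using assoc_mult_mat_vec[OF \<phi>[OF m] A(1), of w] w zero by simp
    also have "\<dots> = 0\<^sub>v r" using \<phi>[OF m] by (intro eq_vecI) auto
    finally show ?thesis using \<phi>[OF m] w zero by auto
  qed
  have W: "?W = {0\<^sub>v r} \<or> ?W = carrier_vec r"
    by (rule irr[unfolded irreducible_representation_def, THEN conjunct2, THEN spec, THEN mp, OF sub, THEN mp])
      (intro ballI inv)
  have "?W \<noteq> carrier_vec r"
  proof
    assume eq: "?W = carrier_vec r"
    have "A *\<^sub>v unit_vec r j = 0\<^sub>v r" if "j < r" for j
    proof -
      have "unit_vec r j \<in> ?W" unfolding eq by (rule unit_vec_carrier)
      then show ?thesis using zero[of "unit_vec r j"] by simp
    qed
    moreover have "A *\<^sub>v unit_vec r j = col A j" if "j < r" for j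
      using A(1) that by (intro eq_vecI) auto
    ultimately have "A = 0\<^sub>m r r"
      using A(1) by (intro mat_col_eqI) auto
    then show False using A(2) by simp
  qed
  moreover have "v \<in> ?W" using v zero by simp
  ultimately show ?thesis using W by blast
qed

text \<open>Composition with \<open>h\<close> is additive, so \<open>h\<close> may be any map of
  carriers here; multiplicativity of \<open>h\<close> enters only when \<open>irr\<close> is
  discharged.\<close>

lemma virtual_character_compose:
  fixes f :: "'a \<Rightarrow> 'k::field"
  assumes f: "virtual_character M f" and h: "h \<in> carrier N \<rightarrow> carrier M"
    and irr: "\<And>\<chi> :: 'a \<Rightarrow> 'k. \<chi> \<in> irreducible_characters M \<Longrightarrow>
      virtual_character N (\<lambda>n\<in>carrier N. \<chi> (h n))"
  shows "virtual_character N (\<lambda>n\<in>carrier N. f (h n))"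
  using f
proof (induction rule: virtual_character_induct)
  case zero
  have eq: "(\<lambda>n\<in>carrier N. (\<lambda>m\<in>carrier M. 0) (h n)) = (\<lambda>n\<in>carrier N. 0)"
    using h by (intro restrict_ext) (simp add: Pi_iff)
  show ?case unfolding eq by (rule virtual_character_zero)
next
  case (add f \<chi>)
  have eq: "(\<lambda>n\<in>carrier N. (\<lambda>m\<in>carrier M. f m + \<chi> m) (h n)) =
      (\<lambda>n\<in>carrier N. (\<lambda>n\<in>carrier N. f (h n)) n + (\<lambda>n\<in>carrier N. \<chi> (h n)) n)"
    using h by (intro restrict_ext) (simp add: Pi_iff)
  show ?case
    unfolding eq by (rule virtual_character_add[OF add.IH irr[OF \<open>\<chi> \<in> irreducible_characters M\<close>]])
next
  case (diff f \<chi>)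
  have eq: "(\<lambda>n\<in>carrier N. (\<lambda>m\<in>carrier M. f m - \<chi> m) (h n)) =
      (\<lambda>n\<in>carrier N. (\<lambda>n\<in>carrier N. f (h n)) n - (\<lambda>n\<in>carrier N. \<chi> (h n)) n)"
    using h by (intro restrict_ext) (simp add: Pi_iff)
  show ?case
    unfolding eq by (rule virtual_character_diff[OF diff.IH irr[OF \<open>\<chi> \<in> irreducible_characters M\<close>]])
qed

text \<open>Only the carrier changes and the unit is kept, so representations restrict as they
  stand, in contrast to the restriction to a maximal subgroup.\<close>

lemma virtual_character_submonoid:
  fixes f :: "'a \<Rightarrow> 'k::field"
  assumes N: "monoid (M\<lparr>carrier := C\<rparr>)" and C: "C \<subseteq> carrier M"
    and f: "virtual_character M f"
  shows "virtual_character (M\<lparr>carrier := C\<rparr>) (\<lambda>n\<in>C. f n)"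
proof -
  have "virtual_character (M\<lparr>carrier := C\<rparr>) (\<lambda>n\<in>carrier (M\<lparr>carrier := C\<rparr>). f n)"
  proof (rule virtual_character_compose[OF f, where h = "\<lambda>x. x"])
    fix \<chi> :: "'a \<Rightarrow> 'k" assume "\<chi> \<in> irreducible_characters M"
    then obtain n \<phi> where \<phi>: "monoid_representation M n \<phi>" "\<chi> = character_of M \<phi>"
      using irreducible_character_obtain by metis
    have rep: "monoid_representation (M\<lparr>carrier := C\<rparr>) n \<phi>"
      using \<phi>(1) C unfolding monoid_representation_def by auto
    have eq: "(\<lambda>n\<in>carrier (M\<lparr>carrier := C\<rparr>). \<chi> n) = character_of (M\<lparr>carrier := C\<rparr>) \<phi>"
      unfolding \<phi>(2) character_of_def using C by (intro restrict_ext) auto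
    show "virtual_character (M\<lparr>carrier := C\<rparr>) (\<lambda>n\<in>carrier (M\<lparr>carrier := C\<rparr>). \<chi> n)"
      unfolding eq by (rule character_of_virtual[OF N rep])
  qed (use C in auto)
  then show ?thesis by simp
qed

text \<open>An injective idempotent is the identity, so by irreducibility \<open>m\<close> acts as \<open>0\<close> or its
  idempotent power acts as \<open>1\<close>.\<close>

lemma irreducible_cyclic_trace:
  fixes \<psi> :: "'a \<Rightarrow> 'k::field mat"
  assumes M: "monoid M" and irr: "irreducible_representation M r \<psi>"
    and m: "m \<in> carrier M" and cyc: "carrier M = range (\<lambda>j::nat. m [^]\<^bsub>M\<^esub> j)"
    and k: "0 < k" and e: "e = m [^]\<^bsub>M\<^esub> (k::nat)" "e \<otimes>\<^bsub>M\<^esub> e = e"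
  shows "mat_trace (\<psi> (e \<otimes>\<^bsub>M\<^esub> m)) = mat_trace (\<psi> m)"
    and "mat_trace (\<psi> e) = 0 \<or> mat_trace (\<psi> e) = of_nat r"
proof -
  interpret monoid M by (rule M)
  have rep: "monoid_representation M r \<psi>" using irr by (simp add: irreducible_representation_def)
  have r: "1 \<le> r" and one: "\<psi> \<one>\<^bsub>M\<^esub> = 1\<^sub>m r" using rep by (auto simp: monoid_representation_def)
  have \<psi>: "\<psi> x \<in> carrier_mat r r" if "x \<in> carrier M" for x
    using rep that by (auto simp: monoid_representation_def)
  have mult: "\<psi> (x \<otimes>\<^bsub>M\<^esub> y) = \<psi> x * \<psi> y" if "x \<in> carrier M" "y \<in> carrier M" for x y
    using rep that by (auto simp: monoid_representation_def)
  have ec: "e \<in> carrier M" using m e by simp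
  have comm: "\<psi> x * \<psi> m = \<psi> m * \<psi> x" if x: "x \<in> carrier M" for x
  proof -
    obtain j :: nat where j: "x = m [^]\<^bsub>M\<^esub> j" using x cyc by auto
    have "x \<otimes>\<^bsub>M\<^esub> m = m \<otimes>\<^bsub>M\<^esub> x" unfolding j using m by (metis nat_pow_Suc nat_pow_Suc2)
    then show ?thesis using mult[OF x m] mult[OF m x] by simp
  qed
  \<comment> \<open>As \<open>k\<close> is positive, \<open>\<psi> m\<close> is a factor of
    \<open>\<psi> e\<close>, so it vanishes only together with \<open>\<psi> e\<close>. Otherwise
    \<open>\<psi> m\<close>, commuting with every matrix of the representation, is injective, and so
    are its powers.\<close>
  have "(\<psi> m = 0\<^sub>m r r \<and> \<psi> e = 0\<^sub>m r r) \<or> \<psi> e = 1\<^sub>m r"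
  proof (cases "\<psi> m = 0\<^sub>m r r")
    case True
    obtain l where l: "k = Suc l" using k by (cases k) auto
    have "\<psi> e = \<psi> (m [^]\<^bsub>M\<^esub> l) * \<psi> m" using mult[of "m [^]\<^bsub>M\<^esub> l" m] m by (simp add: e l)
    also have "\<dots> = 0\<^sub>m r r" using \<psi>[of "m [^]\<^bsub>M\<^esub> l"] m True by simp
    finally show ?thesis using True by simp
  next
    case False
    have inj: "v = 0\<^sub>v r" if "v \<in> carrier_vec r" "\<psi> m *\<^sub>v v = 0\<^sub>v r" for v
      by (rule irreducible_commuting_injective[OF irr \<psi>[OF m] False comm that])
    have pow_inj: "v = 0\<^sub>v r" if "v \<in> carrier_vec r" "\<psi> (m [^]\<^bsub>M\<^esub> j) *\<^sub>v v = 0\<^sub>v r" for v and j :: nat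
      using that
    proof (induction j arbitrary: v)
      case 0
      then show ?case using one by simp
    next
      case (Suc j)
      have "\<psi> (m [^]\<^bsub>M\<^esub> j) *\<^sub>v (\<psi> m *\<^sub>v v) = 0\<^sub>v r"
        using Suc.prems mult[of "m [^]\<^bsub>M\<^esub> j" m] m \<psi>[OF m] \<psi>[of "m [^]\<^bsub>M\<^esub> j"]
          assoc_mult_mat_vec[of "\<psi> (m [^]\<^bsub>M\<^esub> j)" r r "\<psi> m" r v] by simp
      then have "\<psi> m *\<^sub>v v = 0\<^sub>v r"
        by (rule Suc.IH[OF mult_mat_vec_carrier[OF \<psi>[OF m] Suc.prems(1)]])
      then show ?case by (rule inj[OF Suc.prems(1)])
    qed
    have id_act: "\<psi> e *\<^sub>v v = v" if v: "v \<in> carrier_vec r" for v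
    proof -
      let ?u = "\<psi> e *\<^sub>v v"
      have u: "?u \<in> carrier_vec r" by (rule mult_mat_vec_carrier[OF \<psi>[OF ec] v])
      have "\<psi> e *\<^sub>v ?u = ?u"
        using assoc_mult_mat_vec[OF \<psi>[OF ec] \<psi>[OF ec] v] mult[OF ec ec] e(2) by simp
      \<comment> \<open>The injective idempotent kills \<open>?u - v\<close>, which must therefore
        be 0.\<close>
      then have "\<psi> e *\<^sub>v (?u - v) = 0\<^sub>v r"
        using mult_minus_distrib_mat_vec[OF \<psi>[OF ec] u v] u by simp
      then have diff: "?u - v = 0\<^sub>v r" using pow_inj[of "?u - v" k] u v e(1) by simp
      show ?thesis
      proof (rule eq_vecI)
        fix i assume i: "i < dim_vec v"
        then have "(?u - v) $ i = (0\<^sub>v r :: 'k vec) $ i" using diff by simp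
        then show "?u $ i = v $ i" using i u v by simp
      qed (use \<psi>[OF ec] v in auto)
    qed
    have "\<psi> e = 1\<^sub>m r"
    proof (rule mat_col_eqI)
      fix j assume "j < dim_col (1\<^sub>m r :: 'k mat)"
      then have j: "j < r" by simp
      have "col (\<psi> e) j = \<psi> e *\<^sub>v unit_vec r j" using \<psi>[OF ec] j by (intro eq_vecI) auto
      then show "col (\<psi> e) j = col (1\<^sub>m r) j" using id_act[of "unit_vec r j"] j by simp
    qed (use \<psi>[OF ec] in auto)
    then show ?thesis by simp
  qed
  then show "mat_trace (\<psi> (e \<otimes>\<^bsub>M\<^esub> m)) = mat_trace (\<psi> m)"
    "mat_trace (\<psi> e) = 0 \<or> mat_trace (\<psi> e) = of_nat r"
    using mult[OF ec m] \<psi>[OF m] by (auto simp: mat_trace_def)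
qed

text \<open>Both claims are additive in \<open>f\<close> and concern powers of \<open>m\<close>
  only, so \<open>M\<close> may be replaced by the submonoid of these powers and \<open>f\<close> by
  an irreducible character. There \<open>e\<close> acts as 0 or 1 and has trace 0 or the degree,
  which is an integer in the field.\<close>

lemma virtual_character_cyclic:
  fixes f :: "'a \<Rightarrow> 'k::field"
  assumes M: "monoid M" and m: "m \<in> carrier M" and k: "0 < k"
    and e: "e = m [^]\<^bsub>M\<^esub> (k::nat)" "e \<otimes>\<^bsub>M\<^esub> e = e"
    and f: "virtual_character M f"
  shows "f (e \<otimes>\<^bsub>M\<^esub> m) = f m \<and> (\<exists>z. f e = of_int z)"
proof -
  interpret monoid M by (rule M)
  let ?C = "range (\<lambda>j::nat. m [^]\<^bsub>M\<^esub> j)"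
  let ?N = "M\<lparr>carrier := ?C\<rparr>"
  have mult: "x \<otimes>\<^bsub>M\<^esub> y \<in> ?C" if xy: "x \<in> ?C" "y \<in> ?C" for x y
  proof -
    obtain i j :: nat where "x = m [^]\<^bsub>M\<^esub> i" "y = m [^]\<^bsub>M\<^esub> j" using xy by auto
    then have "x \<otimes>\<^bsub>M\<^esub> y = m [^]\<^bsub>M\<^esub> (i + j)" using m by (simp add: nat_pow_mult)
    then show ?thesis by simp
  qed
  have C: "?C \<subseteq> carrier M" using m by auto
  have one: "\<one>\<^bsub>M\<^esub> \<in> ?C" unfolding nat_pow_0[of m, symmetric] by (rule rangeI)
  have "submonoid ?C M" by (rule submonoid.intro[OF C mult one])
  then have N: "monoid ?N" by (rule submonoid.submonoid_is_monoid[OF _ M])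
  have pow: "m [^]\<^bsub>?N\<^esub> j = m [^]\<^bsub>M\<^esub> j" for j :: nat
    by (simp add: nat_pow_def)
  have mC: "m \<in> ?C" using rangeI[of "\<lambda>j::nat. m [^]\<^bsub>M\<^esub> j" 1] m by simp
  have eC: "e \<in> ?C" using e(1) by simp
  define P where "P g \<longleftrightarrow> g (e \<otimes>\<^bsub>M\<^esub> m) = g m \<and> (\<exists>z. g e = of_int z)" for g :: "'a \<Rightarrow> 'k"
  have emC: "e \<otimes>\<^bsub>M\<^esub> m \<in> ?C" by (rule mult[OF eC mC])
  have irr: "P \<chi>" if \<chi>: "\<chi> \<in> irreducible_characters ?N" for \<chi>
  proof -
    obtain r \<psi> where \<psi>: "irreducible_representation ?N r \<psi>" "\<chi> = character_of ?N \<psi>"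
      using irreducible_character_obtain[OF \<chi>] by metis
    have *: "mat_trace (\<psi> (e \<otimes>\<^bsub>M\<^esub> m)) = mat_trace (\<psi> m)"
      "mat_trace (\<psi> e) = 0 \<or> mat_trace (\<psi> e) = of_nat r"
      using irreducible_cyclic_trace[OF N \<psi>(1), of m k e] mC k e by (simp_all add: pow)
    have "\<exists>z. mat_trace (\<psi> e) = of_int z"
      using *(2) by (metis of_int_0 of_int_of_nat_eq)
    then show ?thesis using * mC eC emC by (simp add: P_def \<psi>(2) character_of_def)
  qed
  have "virtual_character ?N (\<lambda>n\<in>?C. f n)" by (rule virtual_character_submonoid[OF N C f])
  then have "P (\<lambda>n\<in>?C. f n)"
  proof (induction rule: virtual_character_induct)
    case zero
    have "\<exists>z. (0::'k) = of_int z" by (metis of_int_0)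
    then show ?case using mC eC emC by (simp add: P_def)
  next
    case (add g \<chi>)
    then obtain z w where "g e = of_int z" "\<chi> e = of_int w" using irr[of \<chi>] unfolding P_def by blast
    then have "\<exists>z. g e + \<chi> e = of_int z" by (metis of_int_add)
    then show ?case
      using mC eC emC add.IH irr[OF \<open>\<chi> \<in> irreducible_characters ?N\<close>] by (simp add: P_def)
  next
    case (diff g \<chi>)
    then obtain z w where "g e = of_int z" "\<chi> e = of_int w" using irr[of \<chi>] unfolding P_def by blast
    then have "\<exists>z. g e - \<chi> e = of_int z" by (metis of_int_diff)
    then show ?case
      using mC eC emC diff.IH irr[OF \<open>\<chi> \<in> irreducible_characters ?N\<close>] by (simp add: P_def)
  qed
  then show ?thesis using mC eC emC by (simp add: P_def)
qed

lemma virtual_character_of_int: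
  assumes "monoid M"
  shows "virtual_character M (\<lambda>m\<in>carrier M. of_int z :: 'k::field)"
proof (induction z rule: int_induct[of _ 0])
  case base
  show ?case unfolding of_int_0 by (rule virtual_character_zero)
next
  case (step1 z)
  have eq: "(\<lambda>m\<in>carrier M. of_int (z + 1) :: 'k) =
      (\<lambda>m\<in>carrier M. (\<lambda>m\<in>carrier M. of_int z) m + (\<lambda>m\<in>carrier M. 1) m)"
    by (intro restrict_ext) simp
  show ?case unfolding eq by (rule virtual_character_add[OF step1.IH virtual_character_one[OF assms]])
next
  case (step2 z)
  have eq: "(\<lambda>m\<in>carrier M. of_int (z - 1) :: 'k) =
      (\<lambda>m\<in>carrier M. (\<lambda>m\<in>carrier M. of_int z) m - (\<lambda>m\<in>carrier M. 1) m)"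
    by (intro restrict_ext) simp
  show ?case unfolding eq by (rule virtual_character_diff[OF step2.IH virtual_character_one[OF assms]])
qed

text \<open>Adding \<open>1 - \<phi> e\<close> to a representation \<open>\<phi>\<close> makes it unital; by the previous lemmas this
  changes the character by an integer.\<close>

lemma virtual_character_semigroup_hom:
  fixes f :: "'a \<Rightarrow> 'k::field"
  assumes M: "monoid M" and N: "monoid N" and f: "virtual_character M f"
    and h: "h \<in> carrier N \<rightarrow> carrier M"
    and h_mult: "\<And>x y. x \<in> carrier N \<Longrightarrow> y \<in> carrier N \<Longrightarrow> h (x \<otimes>\<^bsub>N\<^esub> y) = h x \<otimes>\<^bsub>M\<^esub> h y"
  shows "virtual_character N (\<lambda>n\<in>carrier N. f (h n))"
  using f h
proof (rule virtual_character_compose)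
  interpret M: monoid M by (rule M)
  interpret N: monoid N by (rule N)
  let ?e = "h \<one>\<^bsub>N\<^esub>"
  have e: "?e \<in> carrier M" "?e \<otimes>\<^bsub>M\<^esub> ?e = ?e" using h h_mult[of "\<one>\<^bsub>N\<^esub>" "\<one>\<^bsub>N\<^esub>"] by auto
  fix \<chi> :: "'a \<Rightarrow> 'k" assume \<chi>: "\<chi> \<in> irreducible_characters M"
  then obtain n \<phi> where \<phi>: "monoid_representation M n \<phi>" "\<chi> = character_of M \<phi>"
    using irreducible_character_obtain by metis
  have c: "\<phi> x \<in> carrier_mat n n" if "x \<in> carrier M" for x
    using \<phi>(1) that by (auto simp: monoid_representation_def)
  have \<phi>_mult: "\<phi> (x \<otimes>\<^bsub>M\<^esub> y) = \<phi> x * \<phi> y" if "x \<in> carrier M" "y \<in> carrier M" for x y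
    using \<phi>(1) that by (auto simp: monoid_representation_def)
  have hM: "h x \<in> carrier M" if "x \<in> carrier N" for x using h that by auto
  \<comment> \<open>An idempotent is its own first power, so the integrality statement applies with
    exponent 1.\<close>
  obtain z where z: "\<chi> ?e = of_int z"
    using virtual_character_cyclic[OF M e(1), of 1 ?e \<chi>] e irreducible_virtual_character[OF \<chi>] by auto
  let ?E = "1\<^sub>m n - \<phi> ?e"
  have E: "?E \<in> carrier_mat n n" using c[OF e(1)] by auto
  \<comment> \<open>Cutting down to the image of \<open>\<phi> ?e\<close> could leave the zero
    space, which carries no representation. Padding by the complementary projection keeps the degree
    \<open>n\<close>.\<close>
  define \<psi> where "\<psi> x = \<phi> (h x) + ?E" for x
  \<comment> \<open>\<open>?e\<close> is a two-sided identity for the image of \<open>h\<close>, so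
    \<open>?E\<close> annihilates it from both sides. The mixed terms of
    \<open>\<psi> x * \<psi> y\<close> then disappear.\<close>
  have left: "?E * \<phi> (h x) = 0\<^sub>m n n" if x: "x \<in> carrier N" for x
  proof -
    have "\<phi> ?e * \<phi> (h x) = \<phi> (h x)"
      using \<phi>_mult[OF e(1) hM[OF x]] h_mult[of "\<one>\<^bsub>N\<^esub>" x] x by simp
    then show ?thesis
      using minus_mult_distrib_mat[of "1\<^sub>m n" n n "\<phi> ?e" "\<phi> (h x)" n] c[OF e(1)] c[of "h x"] h x
      by (auto simp: Pi_iff)
  qed
  have right: "\<phi> (h x) * ?E = 0\<^sub>m n n" if x: "x \<in> carrier N" for x
  proof -
    have "\<phi> (h x) * \<phi> ?e = \<phi> (h x)"
      using \<phi>_mult[OF hM[OF x] e(1)] h_mult[of x "\<one>\<^bsub>N\<^esub>"] x by simp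
    then show ?thesis
      using mult_minus_distrib_mat[of "\<phi> (h x)" n n "1\<^sub>m n" n "\<phi> ?e"] c[OF e(1)] c[of "h x"] h x
      by (auto simp: Pi_iff)
  qed
  have minus_zero: "A - 0\<^sub>m n n = A" if "A \<in> carrier_mat n n" for A :: "'k mat"
    using that by (intro eq_matI) auto
  have EE: "?E * ?E = ?E"
    using minus_mult_distrib_mat[OF one_carrier_mat c[OF e(1)] E] right[OF N.one_closed] E
      left_mult_one_mat[OF E] minus_zero[OF E] by metis
  have rep: "monoid_representation N n \<psi>"
    unfolding monoid_representation_def
  proof (intro conjI ballI)
    show "1 \<le> n" using \<phi>(1) by (auto simp: monoid_representation_def)
    show "\<psi> \<in> carrier N \<rightarrow> carrier_mat n n" using c h E by (auto simp: \<psi>_def)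
    show "\<psi> \<one>\<^bsub>N\<^esub> = 1\<^sub>m n" using c[OF e(1)] by (intro eq_matI) (auto simp: \<psi>_def)
    fix x y assume xy: "x \<in> carrier N" "y \<in> carrier N"
    have hx: "\<phi> (h x) \<in> carrier_mat n n" and hy: "\<phi> (h y) \<in> carrier_mat n n" using c h xy by auto
    have "\<psi> x * \<psi> y = \<phi> (h x) * \<phi> (h y) + ?E * \<phi> (h y) + (\<phi> (h x) * ?E + ?E * ?E)"
      unfolding \<psi>_def using hx hy E
      by (simp add: add_mult_distrib_mat[of _ n n _ _ n] mult_add_distrib_mat[of _ n n _ n])
    also have "\<dots> = \<phi> (h x) * \<phi> (h y) + ?E"
      unfolding left[OF xy(2)] right[OF xy(1)] EE using hx hy E by simp
    also have "\<dots> = \<psi> (x \<otimes>\<^bsub>N\<^esub> y)"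
      using \<phi>_mult[OF hM[OF xy(1)] hM[OF xy(2)]] h_mult[OF xy] by (simp add: \<psi>_def)
    finally show "\<psi> (x \<otimes>\<^bsub>N\<^esub> y) = \<psi> x * \<psi> y" by simp
  qed
  have eq: "(\<lambda>x\<in>carrier N. \<chi> (h x)) =
      (\<lambda>x\<in>carrier N. character_of N \<psi> x - (\<lambda>x\<in>carrier N. of_int (int n - z)) x)"
  proof (intro restrict_ext)
    fix x assume x: "x \<in> carrier N"
    then have hx: "h x \<in> carrier M" using h by auto
    have "mat_trace (\<psi> x) = mat_trace (\<phi> (h x)) + (of_nat n - mat_trace (\<phi> ?e))"
      using c[OF hx] c[OF e(1)] by (simp add: \<psi>_def mat_trace_def sum.distrib sum_subtractf)
    moreover have "mat_trace (\<phi> ?e) = of_int z" using z e(1) by (simp add: \<phi>(2) character_of_def)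
    ultimately show "\<chi> (h x) = character_of N \<psi> x - (\<lambda>x\<in>carrier N. of_int (int n - z)) x"
      using x hx by (simp add: \<phi>(2) character_of_def)
  qed
  show "virtual_character N (\<lambda>x\<in>carrier N. \<chi> (h x))"
    unfolding eq
    by (rule virtual_character_diff[OF character_of_virtual[OF N rep] virtual_character_of_int[OF N]])
qed

lemma virtual_character_comm:
  fixes f :: "'a \<Rightarrow> 'k::field"
  assumes M: "monoid M" and f: "virtual_character M f" and xy: "x \<in> carrier M" "y \<in> carrier M"
  shows "f (x \<otimes>\<^bsub>M\<^esub> y) = f (y \<otimes>\<^bsub>M\<^esub> x)"
proof -
  interpret monoid M by (rule M)
  have irr: "\<chi> (x \<otimes>\<^bsub>M\<^esub> y) = \<chi> (y \<otimes>\<^bsub>M\<^esub> x)" if \<chi>: "\<chi> \<in> irreducible_characters M" for \<chi> :: "'a \<Rightarrow> 'k"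
  proof -
    obtain n \<phi> where \<phi>: "monoid_representation M n \<phi>" "\<chi> = character_of M \<phi>"
      using irreducible_character_obtain[OF \<chi>] by metis
    have "\<phi> x \<in> carrier_mat n n" "\<phi> y \<in> carrier_mat n n"
      "\<phi> (x \<otimes>\<^bsub>M\<^esub> y) = \<phi> x * \<phi> y" "\<phi> (y \<otimes>\<^bsub>M\<^esub> x) = \<phi> y * \<phi> x"
      using \<phi>(1) xy by (auto simp: monoid_representation_def)
    then show ?thesis
      using mat_trace_comm[of "\<phi> x" n n "\<phi> y"] xy by (simp add: \<phi>(2) character_of_def)
  qed
  obtain A c where "A \<subseteq> irreducible_characters M"
      "f = (\<lambda>m\<in>carrier M. \<Sum>\<chi>\<in>A. of_int (c \<chi>) * \<chi> m)"
    using f unfolding virtual_character_def by blast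
  then show ?thesis using irr xy by (auto intro!: sum.cong)
qed

section \<open>The ring of virtual characters\<close>

lemma virtual_character_ring_simps [simp]:
  "carrier (virtual_character_ring M) = {f. virtual_character M f}"
  "f \<otimes>\<^bsub>virtual_character_ring M\<^esub> g = (\<lambda>m\<in>carrier M. f m * g m)"
  "\<one>\<^bsub>virtual_character_ring M\<^esub> = (\<lambda>m\<in>carrier M. 1)"
  "\<zero>\<^bsub>virtual_character_ring M\<^esub> = (\<lambda>m\<in>carrier M. 0)"
  "f \<oplus>\<^bsub>virtual_character_ring M\<^esub> g = (\<lambda>m\<in>carrier M. f m + g m)"
  by (simp_all add: virtual_character_ring_def)

lemma virtual_character_eqI:
  assumes "virtual_character M f" "virtual_character M g" "\<And>m. m \<in> carrier M \<Longrightarrow> f m = g m"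
  shows "f = g"
proof -
  have "(\<lambda>m\<in>carrier M. f m) = (\<lambda>m\<in>carrier M. g m)" using assms(3) by (intro restrict_ext)
  then show ?thesis using virtual_character_extensional assms(1,2) by metis
qed

lemma virtual_character_ring_ring:
  assumes M: "monoid M"
  shows "ring (virtual_character_ring M :: ('a \<Rightarrow> 'k::field) ring)"
proof (rule ringI)
  let ?R = "virtual_character_ring M :: ('a \<Rightarrow> 'k::field) ring"
  note closed = virtual_character_add virtual_character_mult[OF M]
    virtual_character_zero virtual_character_one[OF M]
  show "abelian_group ?R"
  proof (rule abelian_groupI)
    fix f assume "f \<in> carrier ?R"
    then have f: "virtual_character M f" by simp
    have "(\<lambda>m\<in>carrier M. (\<lambda>m\<in>carrier M. - f m) m + f m) = (\<lambda>m\<in>carrier M. 0)"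
      by (intro restrict_ext) simp
    then show "\<exists>g\<in>carrier ?R. g \<oplus>\<^bsub>?R\<^esub> f = \<zero>\<^bsub>?R\<^esub>"
      unfolding virtual_character_ring_simps using virtual_character_uminus[OF f] by blast
    show "\<zero>\<^bsub>?R\<^esub> \<oplus>\<^bsub>?R\<^esub> f = f"
      unfolding virtual_character_ring_simps
      by (rule virtual_character_eqI[OF closed(1)[OF closed(3) f] f]) simp
    fix g assume "g \<in> carrier ?R"
    then have g: "virtual_character M g" by simp
    show "f \<oplus>\<^bsub>?R\<^esub> g \<in> carrier ?R"
      unfolding virtual_character_ring_simps using closed(1)[OF f g] by blast
    show "f \<oplus>\<^bsub>?R\<^esub> g = g \<oplus>\<^bsub>?R\<^esub> f"
      unfolding virtual_character_ring_simps by (intro restrict_ext) simp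
    fix h assume "h \<in> carrier ?R"
    show "f \<oplus>\<^bsub>?R\<^esub> g \<oplus>\<^bsub>?R\<^esub> h = f \<oplus>\<^bsub>?R\<^esub> (g \<oplus>\<^bsub>?R\<^esub> h)"
      unfolding virtual_character_ring_simps by (intro restrict_ext) simp
  next
    show "\<zero>\<^bsub>?R\<^esub> \<in> carrier ?R" unfolding virtual_character_ring_simps using closed(3) by blast
  qed
  show "monoid ?R"
  proof (rule monoidI)
    fix f assume "f \<in> carrier ?R"
    then have f: "virtual_character M f" by simp
    show "\<one>\<^bsub>?R\<^esub> \<otimes>\<^bsub>?R\<^esub> f = f"
      unfolding virtual_character_ring_simps
      by (rule virtual_character_eqI[OF closed(2)[OF closed(4) f] f]) simp
    show "f \<otimes>\<^bsub>?R\<^esub> \<one>\<^bsub>?R\<^esub> = f"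
      unfolding virtual_character_ring_simps
      by (rule virtual_character_eqI[OF closed(2)[OF f closed(4)] f]) simp
    fix g assume "g \<in> carrier ?R"
    then have g: "virtual_character M g" by simp
    show "f \<otimes>\<^bsub>?R\<^esub> g \<in> carrier ?R"
      unfolding virtual_character_ring_simps using closed(2)[OF f g] by blast
    fix h assume "h \<in> carrier ?R"
    show "f \<otimes>\<^bsub>?R\<^esub> g \<otimes>\<^bsub>?R\<^esub> h = f \<otimes>\<^bsub>?R\<^esub> (g \<otimes>\<^bsub>?R\<^esub> h)"
      unfolding virtual_character_ring_simps by (intro restrict_ext) simp
  next
    show "\<one>\<^bsub>?R\<^esub> \<in> carrier ?R" unfolding virtual_character_ring_simps using closed(4) by blast
  qed
  fix f g h
  show "(f \<oplus>\<^bsub>?R\<^esub> g) \<otimes>\<^bsub>?R\<^esub> h = f \<otimes>\<^bsub>?R\<^esub> h \<oplus>\<^bsub>?R\<^esub> g \<otimes>\<^bsub>?R\<^esub> h"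
    "h \<otimes>\<^bsub>?R\<^esub> (f \<oplus>\<^bsub>?R\<^esub> g) = h \<otimes>\<^bsub>?R\<^esub> f \<oplus>\<^bsub>?R\<^esub> h \<otimes>\<^bsub>?R\<^esub> g"
    unfolding virtual_character_ring_simps by (intro restrict_ext, simp add: algebra_simps)+
qed

text \<open>Induction on the list: prefixing the head is a ring homomorphism from the binary product
  of the head with the product of the tail.\<close>

lemma ring_hom_RDirProd_list:
  assumes "\<And>e. e \<in> set es \<Longrightarrow> \<phi> e \<in> Ring.ring_hom R (S e)"
  shows "(\<lambda>x. map (\<lambda>e. \<phi> e x) es) \<in> Ring.ring_hom R (RDirProd_list (map S es))"
  using assms
proof (induction es)
  case Nil
  then show ?case by (auto simp: Ring.ring_hom_def monoid.defs)
next
  case (Cons e es)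
  have "(\<lambda>x. (\<phi> e x, map (\<lambda>e. \<phi> e x) es)) \<in> Ring.ring_hom R (RDirProd (S e) (RDirProd_list (map S es)))"
    using Cons.IH Cons.prems[of e] Cons.prems
    by (auto simp: Ring.ring_hom_def RDirProd_def DirProd_def monoid.defs)
  from ring_hom_trans[OF this RDirProd_list_hom1] show ?case by (simp add: comp_def)
qed

lemma class_functionD:
  "f \<in> class_functions M p \<xi> \<Longrightarrow> char_equiv M p \<xi> a b \<Longrightarrow> f a = f b"
  unfolding class_functions_def by blast

section \<open>Idempotents and maximal subgroups of a finite monoid\<close>

context monoid
begin

lemma idempotentsD: "e \<in> idempotents G \<Longrightarrow> e \<in> carrier G" "e \<in> idempotents G \<Longrightarrow> e \<otimes> e = e"
  by (auto simp: idempotents_def)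

lemma idempotent_pow:
  assumes "e \<in> idempotents G" "0 < (n::nat)"
  shows "e [^] n = e"
  using assms(2)
proof (induction n)
  case (Suc n)
  then show ?case using idempotentsD[OF assms(1)] by (cases n) auto
qed simp

text \<open>By finiteness \<open>x [^] i = x [^] (i + d)\<close> for some \<open>i\<close> and
  \<open>d > 0\<close>, so powers are \<open>d\<close>-periodic from exponent \<open>i\<close> on.
  The exponent \<open>i * d\<close> is beyond \<open>i\<close> and a multiple of \<open>d\<close>,
  hence doubling it does not change the power.\<close>

lemma finite_idempotent_power_exists:
  assumes fin: "finite (carrier G)" and x: "x \<in> carrier G"
  obtains k :: nat where "0 < k" "x [^] k \<in> idempotents G"
proof -
  \<comment> \<open>Exponent 0 is left out so that \<open>i\<close>, and with it
    \<open>i * d\<close>, is positive.\<close>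
  have "\<not> inj_on (\<lambda>n::nat. x [^] n) {1..}"
  proof
    assume inj: "inj_on (\<lambda>n::nat. x [^] n) {1..}"
    have "(\<lambda>n::nat. x [^] n) ` {1..} \<subseteq> carrier G" using x by auto
    then have "finite ((\<lambda>n::nat. x [^] n) ` {1..})" using fin by (rule finite_subset)
    then have "finite {1::nat..}" using inj by (rule finite_imageD)
    then show False using infinite_Ici[of "1::nat"] by simp
  qed
  then obtain i j :: nat where ij: "1 \<le> i" "i < j" "x [^] i = x [^] j"
    unfolding inj_on_def by (metis atLeast_iff linorder_neqE_nat)
  define d where "d = j - i"
  have d: "0 < d" "j = i + d" using ij by (auto simp: d_def)
  have shift: "x [^] (n + d * t) = x [^] n" if "i \<le> n" for n t :: nat
  proof (induction t)
    case (Suc t)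
    have "n + d * Suc t = j + (n - i + d * t)" using that d by simp
    then have "x [^] (n + d * Suc t) = x [^] j \<otimes> x [^] (n - i + d * t)"
      by (simp only: nat_pow_mult[OF x])
    also have "\<dots> = x [^] (i + (n - i + d * t))"
      unfolding ij(3)[symmetric] by (rule nat_pow_mult[OF x])
    also have "i + (n - i + d * t) = n + d * t" using that by simp
    finally show ?case using Suc.IH by simp
  qed simp
  have "i \<le> i * d" using d by simp
  then have "x [^] (i * d) \<otimes> x [^] (i * d) = x [^] (i * d)"
    using shift[of "i * d" i] nat_pow_mult[OF x, of "i * d" "i * d"] by (simp add: mult.commute)
  then have "x [^] (i * d) \<in> idempotents G" using x by (simp add: idempotents_def)
  then show thesis using that[of "i * d"] ij d by simp
qed

text \<open>Both sides equal \<open>x [^] (i * j)\<close>. This justifies the definite description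
  in \<open>omega_power\<close>.\<close>

lemma idempotent_power_unique:
  assumes x: "x \<in> carrier G" and i: "0 < (i::nat)" "x [^] i \<in> idempotents G"
    and j: "0 < (j::nat)" "x [^] j \<in> idempotents G"
  shows "x [^] i = x [^] j"
proof -
  have "x [^] i = (x [^] i) [^] j" by (rule idempotent_pow[OF i(2) j(1), symmetric])
  also have "\<dots> = (x [^] j) [^] i" using x by (simp add: nat_pow_pow mult.commute)
  also have "\<dots> = x [^] j" by (rule idempotent_pow[OF j(2) i(1)])
  finally show ?thesis .
qed

lemma omega_power_eqI:
  assumes x: "x \<in> carrier G" and k: "0 < (k::nat)" "x [^] k \<in> idempotents G"
  shows "omega_power G x = x [^] k"
  unfolding omega_power_def
proof (rule the_equality)
  show "x [^] k \<in> idempotents G \<and> (\<exists>j::nat. 0 < j \<and> x [^] k = x [^] j)" using k by blast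
next
  fix e assume "e \<in> idempotents G \<and> (\<exists>j::nat. 0 < j \<and> e = x [^] j)"
  then show "e = x [^] k" using idempotent_power_unique[OF x _ _ k] by blast
qed

lemma omega_powerE:
  assumes fin: "finite (carrier G)" and x: "x \<in> carrier G"
  obtains k :: nat where "0 < k" "omega_power G x = x [^] k" "omega_power G x \<in> idempotents G"
proof -
  obtain k :: nat where k: "0 < k" "x [^] k \<in> idempotents G"
    by (rule finite_idempotent_power_exists[OF fin x])
  show thesis using that[OF k(1)] k omega_power_eqI[OF x k] by simp
qed

lemma pow_commute_self: "x \<in> carrier G \<Longrightarrow> x [^] (k::nat) \<otimes> x = x \<otimes> x [^] k"
  by (metis nat_pow_Suc nat_pow_Suc2)

lemma omega_succ_closed:
  assumes "finite (carrier G)" "x \<in> carrier G"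
  shows "omega_succ G x \<in> carrier G"
  using omega_powerE[OF assms] idempotentsD assms by (metis m_closed omega_succ_def)

text \<open>The idempotent is a power of \<open>x\<close> and so commutes with it. The exponent must
  be positive: the power 0 is the unit of the monoid, not the idempotent.\<close>

lemma omega_succ_pow:
  assumes fin: "finite (carrier G)" and x: "x \<in> carrier G"
  shows "omega_succ G x [^] (Suc n) = omega_power G x \<otimes> x [^] (Suc n)"
proof -
  obtain k :: nat where k: "0 < k" "omega_power G x = x [^] k" "omega_power G x \<in> idempotents G"
    by (rule omega_powerE[OF fin x])
  have e: "omega_power G x \<in> carrier G" "omega_power G x \<otimes> omega_power G x = omega_power G x"
    using idempotentsD[OF k(3)] by auto
  show ?thesis
    unfolding omega_succ_def
  proof (induction n)
    case 0
    then show ?case using e x by simp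
  next
    case (Suc n)
    let ?e = "omega_power G x"
    have "(?e \<otimes> x) [^] (Suc (Suc n)) = (?e \<otimes> x [^] Suc n) \<otimes> (?e \<otimes> x)"
      using Suc.IH by (subst nat_pow_Suc) simp
    also have "\<dots> = ?e \<otimes> (x [^] Suc n \<otimes> ?e) \<otimes> x"
      using e(1) x by (simp add: m_assoc del: nat_pow_Suc)
    also have "x [^] Suc n \<otimes> ?e = ?e \<otimes> x [^] Suc n"
      by (simp only: k(2) nat_pow_mult[OF x] add.commute)
    also have "?e \<otimes> (?e \<otimes> x [^] Suc n) \<otimes> x = (?e \<otimes> ?e) \<otimes> (x [^] Suc n \<otimes> x)"
      using e(1) x by (simp add: m_assoc del: nat_pow_Suc)
    also have "\<dots> = ?e \<otimes> x [^] Suc (Suc n)" using e(2) x by simp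
    finally show ?case .
  qed
qed

text \<open>The exponent that makes \<open>x\<close> idempotent also works here: the power is the
  product of the idempotent with itself.\<close>

lemma omega_power_omega_succ:
  assumes fin: "finite (carrier G)" and x: "x \<in> carrier G"
  shows "omega_power G (omega_succ G x) = omega_power G x"
proof -
  obtain k :: nat where k: "0 < k" "omega_power G x = x [^] k" "omega_power G x \<in> idempotents G"
    by (rule omega_powerE[OF fin x])
  obtain l where l: "k = Suc l" using k(1) by (cases k) auto
  have "omega_succ G x [^] k = omega_power G x"
    using omega_succ_pow[OF fin x, of l] k idempotentsD[OF k(3)] by (simp add: l del: nat_pow_Suc)
  then show ?thesis
    using omega_power_eqI[OF omega_succ_closed[OF fin x] k(1)] k(3) by simp
qed

lemma omega_succ_omega_succ:
  assumes fin: "finite (carrier G)" and x: "x \<in> carrier G"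
  shows "omega_succ G (omega_succ G x) = omega_succ G x"
proof -
  obtain k :: nat where k: "0 < k" "omega_power G x = x [^] k" "omega_power G x \<in> idempotents G"
    by (rule omega_powerE[OF fin x])
  have e: "omega_power G x \<in> carrier G" "omega_power G x \<otimes> omega_power G x = omega_power G x"
    using idempotentsD[OF k(3)] by auto
  have "omega_succ G (omega_succ G x) = omega_power G x \<otimes> omega_succ G x"
    by (subst omega_succ_def) (simp add: omega_power_omega_succ[OF fin x])
  also have "\<dots> = omega_succ G x"
    unfolding omega_succ_def using e x by (simp add: m_assoc[symmetric])
  finally show ?thesis .
qed

section \<open>Local monoids and their unit groups\<close>

lemma local_monoid_carrier:
  assumes "e \<in> idempotents G"
  shows "carrier (local_monoid G e) = {x \<in> carrier G. e \<otimes> x = x \<and> x \<otimes> e = x}"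
proof -
  have e: "e \<in> carrier G" "e \<otimes> e = e" using idempotentsD[OF assms] by auto
  have "e \<otimes> (e \<otimes> m \<otimes> e) = e \<otimes> m \<otimes> e" "e \<otimes> m \<otimes> e \<otimes> e = e \<otimes> m \<otimes> e" if "m \<in> carrier G" for m
    using e that by (simp_all add: m_assoc) (simp add: m_assoc[symmetric])
  moreover have "\<exists>m\<in>carrier G. x = e \<otimes> m \<otimes> e" if "x \<in> carrier G" "e \<otimes> x = x" "x \<otimes> e = x" for x
    using that by metis
  ultimately show ?thesis using e by (auto simp: local_monoid_def)
qed

lemma local_monoid_monoid:
  assumes "e \<in> idempotents G"
  shows "monoid (local_monoid G e)"
proof (rule monoidI)
  have e: "e \<in> carrier G" "e \<otimes> e = e" using idempotentsD[OF assms] by auto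
  have ops: "x \<otimes>\<^bsub>local_monoid G e\<^esub> y = x \<otimes> y" "\<one>\<^bsub>local_monoid G e\<^esub> = e" for x y
    by (auto simp: local_monoid_def)
  note c = local_monoid_carrier[OF assms]
  show "\<one>\<^bsub>local_monoid G e\<^esub> \<in> carrier (local_monoid G e)" unfolding ops c using e by simp
  fix x y z
  assume x: "x \<in> carrier (local_monoid G e)"
  then show "\<one>\<^bsub>local_monoid G e\<^esub> \<otimes>\<^bsub>local_monoid G e\<^esub> x = x"
    "x \<otimes>\<^bsub>local_monoid G e\<^esub> \<one>\<^bsub>local_monoid G e\<^esub> = x" unfolding ops c by auto
  assume y: "y \<in> carrier (local_monoid G e)"
  have "e \<otimes> (x \<otimes> y) = x \<otimes> y" "x \<otimes> y \<otimes> e = x \<otimes> y"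
    using x y e unfolding c by (simp_all add: m_assoc) (simp add: m_assoc[symmetric])
  then show "x \<otimes>\<^bsub>local_monoid G e\<^esub> y \<in> carrier (local_monoid G e)"
    using x y unfolding ops c by auto
  assume "z \<in> carrier (local_monoid G e)"
  then show "x \<otimes>\<^bsub>local_monoid G e\<^esub> y \<otimes>\<^bsub>local_monoid G e\<^esub> z =
      x \<otimes>\<^bsub>local_monoid G e\<^esub> (y \<otimes>\<^bsub>local_monoid G e\<^esub> z)"
    using x y unfolding ops c by (auto simp: m_assoc)
qed

lemma maximal_subgroup_group: "e \<in> idempotents G \<Longrightarrow> group (maximal_subgroup G e)"
  unfolding maximal_subgroup_def by (rule monoid.units_group[OF local_monoid_monoid])

lemma maximal_subgroup_simps [simp]:
  "x \<otimes>\<^bsub>maximal_subgroup G e\<^esub> y = x \<otimes> y" "\<one>\<^bsub>maximal_subgroup G e\<^esub> = e"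
  by (auto simp: maximal_subgroup_def units_of_def local_monoid_def)

lemma maximal_subgroup_carrier_iff:
  assumes "e \<in> idempotents G"
  shows "x \<in> carrier (maximal_subgroup G e) \<longleftrightarrow> x \<in> carrier G \<and> e \<otimes> x = x \<and> x \<otimes> e = x \<and>
    (\<exists>y\<in>carrier G. e \<otimes> y = y \<and> y \<otimes> e = y \<and> y \<otimes> x = e \<and> x \<otimes> y = e)"
proof -
  have ops: "x \<otimes>\<^bsub>local_monoid G e\<^esub> y = x \<otimes> y" "\<one>\<^bsub>local_monoid G e\<^esub> = e" for x y
    by (auto simp: local_monoid_def)
  show ?thesis
    unfolding maximal_subgroup_def units_of_def Units_def
    by (auto simp: ops local_monoid_carrier[OF assms])
qed

text \<open>Left multiplication by \<open>q\<close> maps the finite set \<open>?S\<close> of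
  elements fixed by \<open>e\<close> from the left into itself, injectively because \<open>p\<close>
  undoes it. It is thus onto and produces a right inverse \<open>z\<close> of \<open>q\<close>,
  which must be \<open>p\<close>.\<close>

lemma finite_local_inverse_commute:
  assumes fin: "finite (carrier G)" and e: "e \<in> idempotents G"
    and p: "p \<in> carrier G" "p \<otimes> e = p" and q: "q \<in> carrier G" "e \<otimes> q = q" and pq: "p \<otimes> q = e"
  shows "q \<otimes> p = e"
proof -
  have ec: "e \<in> carrier G" "e \<otimes> e = e" using idempotentsD[OF e] by auto
  let ?S = "{z \<in> carrier G. e \<otimes> z = z}"
  have inj: "inj_on (\<lambda>z. q \<otimes> z) ?S"
  proof (rule inj_onI)
    fix z w assume zw: "z \<in> ?S" "w \<in> ?S" "q \<otimes> z = q \<otimes> w"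
    then have "p \<otimes> q \<otimes> z = p \<otimes> q \<otimes> w" using p(1) q(1) by (simp add: m_assoc)
    then show "z = w" using zw pq by simp
  qed
  have sub: "(\<lambda>z. q \<otimes> z) ` ?S \<subseteq> ?S"
    using q ec by (auto simp: m_assoc[symmetric])
  have "finite ?S" using fin by simp
  then have "(\<lambda>z. q \<otimes> z) ` ?S = ?S" using sub inj by (rule endo_inj_surj)
  moreover have "e \<in> ?S" using ec by simp
  ultimately obtain z where z: "z \<in> carrier G" "e \<otimes> z = z" "q \<otimes> z = e" by force
  have "p = p \<otimes> (q \<otimes> z)" using z(3) p(2) by simp
  also have "\<dots> = p \<otimes> q \<otimes> z" using p(1) q(1) z(1) by (simp add: m_assoc)
  also have "\<dots> = z" using pq z(2) by simp
  finally show ?thesis using z(3) by simp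
qed

text \<open>Compressing \<open>y\<close> to \<open>e \<otimes> y \<otimes> e\<close> gives a left
  inverse inside the local monoid; by finiteness it is two-sided.\<close>

lemma maximal_subgroup_leftI:
  assumes fin: "finite (carrier G)" and e: "e \<in> idempotents G"
    and x: "x \<in> carrier G" "e \<otimes> x = x" "x \<otimes> e = x" and y: "y \<in> carrier G" "y \<otimes> x = e"
  shows "x \<in> carrier (maximal_subgroup G e)"
proof -
  have ec: "e \<in> carrier G" "e \<otimes> e = e" using idempotentsD[OF e] by auto
  let ?y = "e \<otimes> y \<otimes> e"
  have yc: "?y \<in> carrier G" using ec y by simp
  have ye: "?y \<otimes> e = ?y" using ec y(1) by (simp add: m_assoc)
  have ey: "e \<otimes> ?y = ?y" using ec y(1) by (simp add: m_assoc[symmetric])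
  have "?y \<otimes> x = e \<otimes> (y \<otimes> x)" using ec y(1) x by (simp add: m_assoc)
  then have yx: "?y \<otimes> x = e" using y(2) ec by simp
  have "x \<otimes> ?y = e" by (rule finite_local_inverse_commute[OF fin e yc ye x(1,2) yx])
  then show ?thesis unfolding maximal_subgroup_carrier_iff[OF e] using x yc ye ey yx by blast
qed

text \<open>If \<open>x [^] k\<close> is the idempotent, then \<open>x [^] (k - 1)\<close> is a left
  inverse relative to it.\<close>

lemma omega_succ_maximal_subgroup:
  assumes fin: "finite (carrier G)" and x: "x \<in> carrier G"
  shows "omega_succ G x \<in> carrier (maximal_subgroup G (omega_power G x))"
proof -
  obtain k :: nat where k: "0 < k" "omega_power G x = x [^] k" "omega_power G x \<in> idempotents G"
    by (rule omega_powerE[OF fin x])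
  obtain l where l: "k = Suc l" using k(1) by (cases k) auto
  let ?e = "omega_power G x"
  have e: "?e \<in> carrier G" "?e \<otimes> ?e = ?e" using idempotentsD[OF k(3)] by auto
  have comm: "x \<otimes> ?e = ?e \<otimes> x" unfolding k(2) by (rule pow_commute_self[OF x, symmetric])
  show ?thesis
  proof (rule maximal_subgroup_leftI[OF fin k(3)])
    show "omega_succ G x \<in> carrier G" by (rule omega_succ_closed[OF fin x])
    show "?e \<otimes> omega_succ G x = omega_succ G x"
      unfolding omega_succ_def using e x by (simp add: m_assoc[symmetric])
    show "omega_succ G x \<otimes> ?e = omega_succ G x"
      unfolding omega_succ_def using e x comm by (metis m_assoc m_closed)
    show "x [^] l \<in> carrier G" using x by simp
    have "x [^] l \<otimes> (?e \<otimes> x) = x [^] l \<otimes> (x \<otimes> ?e)" using comm by simp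
    also have "\<dots> = x [^] l \<otimes> x \<otimes> ?e" using x e by (simp add: m_assoc)
    also have "\<dots> = ?e" using k(2) e(2) by (simp add: l)
    finally show "x [^] l \<otimes> omega_succ G x = ?e" unfolding omega_succ_def .
  qed
qed

section \<open>Two-sided ideals and \<open>D\<close>-equivalence\<close>

lemma D_equivalent_refl: "e \<in> idempotents G \<Longrightarrow> D_equivalent G e e"
  unfolding D_equivalent_def using idempotentsD by metis

text \<open>In a finite monoid, idempotents generating the same two-sided ideal are
  \<open>D\<close>-equivalent. The first factorization gives \<open>x\<close> and \<open>y\<close>
  with \<open>x \<otimes> y = e\<close>, so \<open>y \<otimes> x\<close> is an idempotent fixed by
  \<open>f\<close> on both sides. Finiteness forces it to be \<open>f\<close>.\<close>

lemma finite_J_imp_D_equivalent: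
  assumes fin: "finite (carrier G)" and e: "e \<in> idempotents G" and f: "f \<in> idempotents G"
    and ef: "a \<in> carrier G" "b \<in> carrier G" "e = a \<otimes> f \<otimes> b"
    and fe: "c \<in> carrier G" "d \<in> carrier G" "f = c \<otimes> e \<otimes> d"
  shows "D_equivalent G e f"
proof -
  have ec: "e \<in> carrier G" "e \<otimes> e = e" and fc: "f \<in> carrier G" "f \<otimes> f = f"
    using idempotentsD e f by auto
  define x where "x = e \<otimes> a \<otimes> f"
  define y where "y = f \<otimes> b \<otimes> e"
  have xy: "x \<in> carrier G" "y \<in> carrier G" using ec fc ef by (auto simp: x_def y_def)
  have ff: "f \<otimes> (f \<otimes> z) = f \<otimes> z" if "z \<in> carrier G" for z
    using fc that by (simp add: m_assoc[symmetric])
  have ee: "e \<otimes> (e \<otimes> z) = e \<otimes> z" if "z \<in> carrier G" for z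
    using ec that by (simp add: m_assoc[symmetric])
  have "x \<otimes> y = e \<otimes> (a \<otimes> f \<otimes> b) \<otimes> e"
    using ec fc ef(1,2) ff by (simp add: x_def y_def m_assoc)
  then have x_y: "x \<otimes> y = e" using ef(3) ec by simp
  have ex: "e \<otimes> x = x" and ye: "y \<otimes> e = y" and fy: "f \<otimes> y = y" and xf: "x \<otimes> f = x"
    using ec fc ef(1,2) ff ee by (simp_all add: x_def y_def m_assoc)
  define u where "u = y \<otimes> x"
  have uc: "u \<in> carrier G" using xy by (simp add: u_def)
  have fu: "f \<otimes> u = u" using fc xy fy by (simp add: u_def m_assoc[symmetric])
  have uf: "u \<otimes> f = u" using fc xy xf by (simp add: u_def m_assoc)
  have "x \<otimes> u \<otimes> y = (x \<otimes> y) \<otimes> (x \<otimes> y)" using xy by (simp add: u_def m_assoc)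
  then have xuy: "x \<otimes> u \<otimes> y = e" using x_y ec by simp
  have uu: "u \<otimes> u = u"
  proof -
    have "u \<otimes> u = y \<otimes> (x \<otimes> y) \<otimes> x" using xy by (simp add: u_def m_assoc)
    then show ?thesis using x_y ye by (simp add: u_def)
  qed
  \<comment> \<open>Substituting \<open>x \<otimes> u \<otimes> y\<close> for \<open>e\<close> in
    \<open>c \<otimes> e \<otimes> d\<close> and doubling the idempotent \<open>u\<close> factors
    \<open>f\<close> through \<open>u\<close>. The factors commute by finiteness, so
    \<open>f\<close> starts with \<open>u\<close> as well.\<close>
  define p where "p = f \<otimes> c \<otimes> x \<otimes> u"
  define q where "q = u \<otimes> y \<otimes> d \<otimes> f"
  have pq_c: "p \<in> carrier G" "q \<in> carrier G" using fc fe xy uc by (auto simp: p_def q_def)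
  have "p \<otimes> q = f \<otimes> (c \<otimes> (x \<otimes> (u \<otimes> u) \<otimes> y) \<otimes> d) \<otimes> f"
    using fc fe(1,2) xy uc by (simp add: p_def q_def m_assoc)
  then have pq: "p \<otimes> q = f" using uu xuy fe(3) fc by simp
  have pf: "p \<otimes> f = p" using fc fe xy uc uf by (simp add: p_def m_assoc)
  have "f \<otimes> q = (f \<otimes> u) \<otimes> y \<otimes> d \<otimes> f" using fc fe xy uc by (simp add: q_def m_assoc)
  then have fq: "f \<otimes> q = q" using fu by (simp add: q_def)
  have "q \<otimes> p = f" by (rule finite_local_inverse_commute[OF fin f pq_c(1) pf pq_c(2) fq pq])
  moreover have "u \<otimes> q = q"
    using fc fe xy uc uu by (simp add: q_def m_assoc[symmetric])
  ultimately have "u \<otimes> f = f" using pq_c uc by (metis m_assoc)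
  then have uf_eq: "u = f" using uf by simp
  have "x \<otimes> y \<otimes> x = x" using x_y ex by simp
  moreover have "y \<otimes> x \<otimes> y = y" using uf_eq fy by (simp add: u_def)
  ultimately show ?thesis
    unfolding D_equivalent_def using xy x_y uf_eq u_def by metis
qed

text \<open>Conjugation by the witnesses of a \<open>D\<close>-equivalence identifies the maximal subgroups.\<close>

lemma trace_like_eqI:
  fixes f g :: "'a \<Rightarrow> 'k"
  assumes fin: "finite (carrier G)" and reps: "D_class_representatives G es"
    and f_comm: "\<And>x y. x \<in> carrier G \<Longrightarrow> y \<in> carrier G \<Longrightarrow> f (x \<otimes> y) = f (y \<otimes> x)"
    and g_comm: "\<And>x y. x \<in> carrier G \<Longrightarrow> y \<in> carrier G \<Longrightarrow> g (x \<otimes> y) = g (y \<otimes> x)"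
    and f_omega: "\<And>x. x \<in> carrier G \<Longrightarrow> f (omega_succ G x) = f x"
    and g_omega: "\<And>x. x \<in> carrier G \<Longrightarrow> g (omega_succ G x) = g x"
    and eq: "\<And>e x. e \<in> set es \<Longrightarrow> x \<in> carrier (maximal_subgroup G e) \<Longrightarrow> f x = g x"
    and x: "x \<in> carrier G"
  shows "f x = g x"
proof -
  let ?h = "omega_succ G x"
  obtain k :: nat where k: "0 < k" "omega_power G x = x [^] k" "omega_power G x \<in> idempotents G"
    by (rule omega_powerE[OF fin x])
  define u where "u = omega_power G x"
  have u: "u \<in> idempotents G" using k(3) by (simp add: u_def)
  obtain i where i: "i < length es" "D_equivalent G (es ! i) u"
    using reps u unfolding D_class_representatives_def by blast
  define e where "e = es ! i"
  have e_es: "e \<in> set es" using i by (simp add: e_def)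
  have e: "e \<in> idempotents G" using e_es reps unfolding D_class_representatives_def by blast
  obtain a b where ab: "a \<in> carrier G" "b \<in> carrier G" "a \<otimes> b \<otimes> a = a" "b \<otimes> a \<otimes> b = b"
      "a \<otimes> b = e" "b \<otimes> a = u"
    using i(2) unfolding D_equivalent_def e_def by blast
  have h: "?h \<in> carrier (maximal_subgroup G u)"
    unfolding u_def by (rule omega_succ_maximal_subgroup[OF fin x])
  then obtain h' where h': "?h \<in> carrier G" "u \<otimes> ?h = ?h" "?h \<otimes> u = ?h" "h' \<in> carrier G" "h' \<otimes> ?h = u"
      "u \<otimes> h' = h'"
    unfolding maximal_subgroup_carrier_iff[OF u] by blast
  \<comment> \<open>The image of \<open>?h\<close> under the isomorphism of maximal subgroups given
    by \<open>a\<close> and \<open>b\<close>; its inverse is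
    \<open>a \<otimes> h' \<otimes> b\<close>.\<close>
  define w where "w = a \<otimes> ?h \<otimes> b"
  have wc: "w \<in> carrier G" using ab h' by (simp add: w_def)
  have ea: "e \<otimes> a = a" and be: "b \<otimes> e = b" using ab by (auto simp: m_assoc)
  have "w \<in> carrier (maximal_subgroup G e)"
  proof (rule maximal_subgroup_leftI[OF fin e wc])
    have ec: "e \<in> carrier G" using idempotentsD e by blast
    have "e \<otimes> w = (e \<otimes> a) \<otimes> ?h \<otimes> b" using ab(1,2) h'(1) ec by (simp add: w_def m_assoc)
    then show "e \<otimes> w = w" using ea by (simp add: w_def)
    have "w \<otimes> e = a \<otimes> ?h \<otimes> (b \<otimes> e)" using ab(1,2) h'(1) ec by (simp add: w_def m_assoc)
    then show "w \<otimes> e = w" using be by (simp add: w_def)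
    show "a \<otimes> h' \<otimes> b \<in> carrier G" using ab h' by simp
    have "(a \<otimes> h' \<otimes> b) \<otimes> w = a \<otimes> h' \<otimes> ((b \<otimes> a) \<otimes> ?h) \<otimes> b"
      using ab(1,2) h'(1,4) by (simp add: w_def m_assoc)
    also have "\<dots> = a \<otimes> (h' \<otimes> ?h) \<otimes> b"
      unfolding ab(6) h'(2) using ab(1,2) h'(1,4) by (simp add: m_assoc)
    also have "\<dots> = (a \<otimes> b \<otimes> a) \<otimes> b" unfolding h'(5) ab(6)[symmetric] using ab(1,2) by (simp add: m_assoc)
    also have "\<dots> = e" by (subst ab(3)) (rule ab(5))
    finally show "(a \<otimes> h' \<otimes> b) \<otimes> w = e" .
  qed
  then have fg: "f w = g w" by (rule eq[OF e_es])
  \<comment> \<open>Moving \<open>a\<close> to the other end of \<open>w\<close> leaves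
    \<open>?h\<close> times the idempotent \<open>u\<close>, so \<open>w\<close> and
    \<open>?h\<close> have equal values.\<close>
  have "?h \<otimes> b \<otimes> a = ?h" using h' ab by (simp add: m_assoc)
  moreover have "?h \<otimes> b \<in> carrier G" "w = a \<otimes> (?h \<otimes> b)" using h' ab by (simp_all add: w_def m_assoc)
  ultimately have "f w = f ?h" "g w = g ?h"
    using f_comm[of a "?h \<otimes> b"] g_comm[of a "?h \<otimes> b"] ab(1) by simp_all
  then show ?thesis using fg f_omega[OF x] g_omega[OF x] by simp
qed

subsection \<open>Induction from a maximal subgroup\<close>

text \<open>Green's \<open>L\<close>-class of an idempotent \<open>e\<close>: the first condition
  puts \<open>x\<close> into the left ideal of \<open>e\<close>, the second puts \<open>e\<close>
  into that of \<open>x\<close>.\<close>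

definition left_class :: "'a \<Rightarrow> 'a set" where
  "left_class e = {x \<in> carrier G. x \<otimes> e = x \<and> (\<exists>y\<in>carrier G. y \<otimes> x = e)}"

definition right_orbit :: "'a \<Rightarrow> 'a \<Rightarrow> 'a set" where
  "right_orbit e x = {x \<otimes> g | g. g \<in> carrier (maximal_subgroup G e)}"

text \<open>Choosing \<open>e\<close> in its own orbit makes the induced action below restrict on \<open>G\<^sub>e\<close> to
  \<open>\<rho>\<close> itself instead of a conjugate.\<close>

definition orbit_representative :: "'a \<Rightarrow> 'a \<Rightarrow> 'a" where
  "orbit_representative e x =
     (if e \<in> right_orbit e x then e else SOME c. c \<in> right_orbit e x)"

text \<open>The maximal subgroup acts freely on the right, since \<open>x\<close> has a left inverse
  relative to \<open>e\<close>. Hence the group element described in \<open>induced_action\<close>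
  is unique.\<close>

lemma left_class_cancel:
  assumes e: "e \<in> idempotents G" and x: "x \<in> left_class e"
    and g: "g \<in> carrier (maximal_subgroup G e)" and h: "h \<in> carrier (maximal_subgroup G e)"
    and eq: "x \<otimes> g = x \<otimes> h"
  shows "g = h"
proof -
  obtain y where y: "y \<in> carrier G" "y \<otimes> x = e" and xc: "x \<in> carrier G"
    using x by (auto simp: left_class_def)
  have gh: "g \<in> carrier G" "h \<in> carrier G" "e \<otimes> g = g" "e \<otimes> h = h"
    using g h unfolding maximal_subgroup_carrier_iff[OF e] by auto
  have "y \<otimes> x \<otimes> g = y \<otimes> x \<otimes> h"
    using eq m_assoc[OF y(1) xc gh(1)] m_assoc[OF y(1) xc gh(2)] by simp
  then show ?thesis using y gh by simp
qed

lemma left_class_mult_right: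
  assumes e: "e \<in> idempotents G" and x: "x \<in> left_class e"
    and g: "g \<in> carrier (maximal_subgroup G e)"
  shows "x \<otimes> g \<in> left_class e"
proof -
  obtain y where y: "y \<in> carrier G" "y \<otimes> x = e" and xc: "x \<in> carrier G"
    using x by (auto simp: left_class_def)
  obtain h where gh: "g \<in> carrier G" "e \<otimes> g = g" "g \<otimes> e = g" "h \<in> carrier G" "h \<otimes> g = e"
    using g unfolding maximal_subgroup_carrier_iff[OF e] by auto
  have "h \<otimes> y \<otimes> (x \<otimes> g) = h \<otimes> ((y \<otimes> x) \<otimes> g)" using y(1) xc gh(1,4) by (simp add: m_assoc)
  then have "h \<otimes> y \<otimes> (x \<otimes> g) = e" using y(2) gh by simp
  moreover have "x \<otimes> g \<otimes> e = x \<otimes> g" using xc gh(1,3) idempotentsD(1)[OF e] by (simp add: m_assoc)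
  moreover have "x \<otimes> g \<in> carrier G" "h \<otimes> y \<in> carrier G" using xc gh y by simp_all
  ultimately show ?thesis unfolding left_class_def by blast
qed

text \<open>A product that has left the class cannot return by further left multiplication, so
  counting it as 0 is compatible with multiplication.\<close>

lemma left_class_mult_leftD:
  assumes e: "e \<in> idempotents G" and x: "x \<in> carrier G" "x \<otimes> e = x"
    and m: "m \<in> carrier G" and mx: "m \<otimes> x \<in> left_class e"
  shows "x \<in> left_class e"
proof -
  obtain y where y: "y \<in> carrier G" "y \<otimes> (m \<otimes> x) = e"
    using mx by (auto simp: left_class_def)
  then have "(y \<otimes> m) \<otimes> x = e" using x m by (simp add: m_assoc)
  then show ?thesis unfolding left_class_def using x m y by blast
qed

lemma right_orbit_eq:
  assumes e: "e \<in> idempotents G" and x: "x \<in> left_class e" and y: "y \<in> right_orbit e x"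
  shows "right_orbit e y = right_orbit e x"
proof -
  interpret N: group "maximal_subgroup G e" by (rule maximal_subgroup_group[OF e])
  have Nc: "\<And>g. g \<in> carrier (maximal_subgroup G e) \<Longrightarrow> g \<in> carrier G"
    unfolding maximal_subgroup_carrier_iff[OF e] by blast
  have xc: "x \<in> carrier G" "x \<otimes> e = x" using x by (auto simp: left_class_def)
  obtain g where g: "g \<in> carrier (maximal_subgroup G e)" "y = x \<otimes> g"
    using y by (auto simp: right_orbit_def)
  show ?thesis
  proof (intro equalityI subsetI)
    fix z assume "z \<in> right_orbit e y"
    then obtain h where h: "h \<in> carrier (maximal_subgroup G e)" "z = x \<otimes> g \<otimes> h"
      using g(2) by (auto simp: right_orbit_def)
    have "z = x \<otimes> (g \<otimes> h)" using h xc Nc[OF g(1)] Nc[OF h(1)] by (simp add: m_assoc)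
    moreover have "g \<otimes> h \<in> carrier (maximal_subgroup G e)" using N.m_closed[OF g(1) h(1)] by simp
    ultimately show "z \<in> right_orbit e x" by (auto simp: right_orbit_def)
  next
    fix z assume "z \<in> right_orbit e x"
    then obtain h where h: "h \<in> carrier (maximal_subgroup G e)" "z = x \<otimes> h"
      by (auto simp: right_orbit_def)
    let ?i = "inv\<^bsub>maximal_subgroup G e\<^esub> g"
    have i: "?i \<in> carrier (maximal_subgroup G e)" "g \<otimes> ?i = e"
      using N.inv_closed[OF g(1)] N.r_inv[OF g(1)] by auto
    have "y \<otimes> (?i \<otimes> h) = x \<otimes> (g \<otimes> ?i) \<otimes> h"
      using g(2) xc Nc[OF g(1)] Nc[OF h(1)] Nc[OF i(1)] by (simp add: m_assoc)
    then have "z = y \<otimes> (?i \<otimes> h)" using i xc h by simp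
    moreover have "?i \<otimes> h \<in> carrier (maximal_subgroup G e)" using N.m_closed[OF i(1) h(1)] by simp
    ultimately show "z \<in> right_orbit e y" by (auto simp: right_orbit_def)
  qed
qed

lemma right_orbit_self:
  assumes e: "e \<in> idempotents G" and x: "x \<in> left_class e"
  shows "x \<in> right_orbit e x"
proof -
  interpret N: group "maximal_subgroup G e" by (rule maximal_subgroup_group[OF e])
  have "x = x \<otimes> e" using x by (simp add: left_class_def)
  moreover have "e \<in> carrier (maximal_subgroup G e)" using N.one_closed by simp
  ultimately show ?thesis unfolding right_orbit_def by blast
qed

lemma orbit_representative_in_orbit:
  assumes e: "e \<in> idempotents G" and x: "x \<in> left_class e"
  shows "orbit_representative e x \<in> right_orbit e x"
  unfolding orbit_representative_def using right_orbit_self[OF e x] someI[of "\<lambda>c. c \<in> right_orbit e x" x]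
  by simp

lemma right_orbit_subset:
  assumes e: "e \<in> idempotents G" and x: "x \<in> left_class e"
  shows "right_orbit e x \<subseteq> left_class e"
  using left_class_mult_right[OF e x] by (auto simp: right_orbit_def)

text \<open>The representative of \<open>x\<close> depends on \<open>x\<close> only through its
  orbit, so the image of \<open>orbit_representative e\<close> is a transversal.\<close>

lemma orbit_representative_unique:
  assumes e: "e \<in> idempotents G"
    and a: "a \<in> orbit_representative e ` left_class e"
    and b: "b \<in> orbit_representative e ` left_class e" and ba: "b \<in> right_orbit e a"
  shows "b = a"
proof -
  have fixed: "orbit_representative e c = c \<and> c \<in> left_class e"
    if c: "c \<in> orbit_representative e ` left_class e" for c
  proof -
    obtain x where x: "x \<in> left_class e" "c = orbit_representative e x" using c by blast
    have cx: "c \<in> right_orbit e x" using orbit_representative_in_orbit[OF e x(1)] x(2) by simp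
    have "right_orbit e c = right_orbit e x" by (rule right_orbit_eq[OF e x(1) cx])
    then have "orbit_representative e c = orbit_representative e x"
      by (simp only: orbit_representative_def)
    then have "orbit_representative e c = c" using x(2) by simp
    then show ?thesis using right_orbit_subset[OF e x(1)] cx by blast
  qed
  have "right_orbit e b = right_orbit e a" using right_orbit_eq[OF e _ ba] fixed[OF a] by blast
  then have "orbit_representative e b = orbit_representative e a"
    by (simp add: orbit_representative_def)
  then show ?thesis using fixed[OF a] fixed[OF b] by simp
qed

text \<open>The block monomial matrices by which \<open>m\<close> acts on \<open>K L\<^sub>e \<otimes> V\<close>, the tensor product over the
  group algebra of \<open>G\<^sub>e\<close>, where \<open>V\<close> affords \<open>\<rho>\<close> and \<open>a\<close>, \<open>b\<close> run through a transversal of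
  \<open>L\<^sub>e/G\<^sub>e\<close>; a product that leaves \<open>L\<^sub>e\<close> counts as \<open>0\<close>.\<close>

definition induced_action ::
    "'a \<Rightarrow> ('a \<Rightarrow> 'k::field mat) \<Rightarrow> 'a \<Rightarrow> 'a \<times> nat \<Rightarrow> 'a \<times> nat \<Rightarrow> 'k" where
  "induced_action e \<rho> m = (\<lambda>(a, i) (b, j).
     if \<exists>g\<in>carrier (maximal_subgroup G e). m \<otimes> b = a \<otimes> g
     then \<rho> (THE g. g \<in> carrier (maximal_subgroup G e) \<and> m \<otimes> b = a \<otimes> g) $$ (i, j) else 0)"

lemma induced_action_eq:
  assumes e: "e \<in> idempotents G" and a: "a \<in> left_class e"
    and g: "g \<in> carrier (maximal_subgroup G e)" "m \<otimes> b = a \<otimes> g"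
  shows "induced_action e \<rho> m (a, i) (b, j) = \<rho> g $$ (i, j)"
proof -
  have "(THE g. g \<in> carrier (maximal_subgroup G e) \<and> m \<otimes> b = a \<otimes> g) = g"
    using g left_class_cancel[OF e a] by (intro the_equality) auto
  then show ?thesis unfolding induced_action_def using g by auto
qed

lemma induced_action_eq_0:
  assumes "\<And>g. g \<in> carrier (maximal_subgroup G e) \<Longrightarrow> m \<otimes> b \<noteq> a \<otimes> g"
  shows "induced_action e \<rho> m (a, i) (b, j) = 0"
  unfolding induced_action_def using assms by auto

text \<open>Each block column has at most one nonzero block: \<open>y \<otimes> b\<close> either
  leaves the class or equals \<open>c \<otimes> h\<close> for one representative \<open>c\<close>.
  If also \<open>x \<otimes> c = a \<otimes> g\<close>, then \<open>x \<otimes> y\<close> sends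
  \<open>b\<close> to \<open>a \<otimes> (g \<otimes> h)\<close>, and multiplicativity of
  \<open>\<rho>\<close> gives the product.\<close>

lemma induced_matrix_action:
  fixes \<rho> :: "'a \<Rightarrow> 'k::field mat"
  assumes fin: "finite (carrier G)" and e: "e \<in> idempotents G"
    and \<rho>: "monoid_representation (maximal_subgroup G e) n \<rho>"
  shows "matrix_action G (orbit_representative e ` left_class e \<times> {..<n}) (induced_action e \<rho>)"
    (is "matrix_action G (?R \<times> _) ?A")
proof -
  let ?N = "maximal_subgroup G e"
  interpret N: group ?N by (rule maximal_subgroup_group[OF e])
  have Nc: "\<And>g. g \<in> carrier ?N \<Longrightarrow> g \<in> carrier G"
    unfolding maximal_subgroup_carrier_iff[OF e] by blast
  have eN: "e \<in> carrier ?N" using N.one_closed by simp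
  have L: "x \<in> carrier G" "x \<otimes> e = x" if "x \<in> left_class e" for x
    using that by (auto simp: left_class_def)
  have RL: "?R \<subseteq> left_class e"
    using orbit_representative_in_orbit[OF e] right_orbit_subset[OF e] by blast
  have orb: "x \<in> right_orbit e y \<longleftrightarrow> (\<exists>g\<in>carrier ?N. x = y \<otimes> g)" for x y
    by (auto simp: right_orbit_def)
  have \<rho>_one: "\<rho> e = 1\<^sub>m n" using \<rho> by (auto simp: monoid_representation_def)
  have \<rho>_mult: "\<rho> (g \<otimes> h) $$ (i, j) = (\<Sum>l<n. \<rho> g $$ (i, l) * \<rho> h $$ (l, j))"
    if "g \<in> carrier ?N" "h \<in> carrier ?N" "i < n" "j < n" for g h i j
    using representation_matrix_action[OF \<rho>] that by (auto simp: matrix_action_def)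
  have finR: "finite ?R" using fin by (auto simp: left_class_def)
  show ?thesis
    unfolding matrix_action_def
  proof (intro conjI ballI)
    show "finite (?R \<times> {..<n})" using finR by simp
  next
    fix s t assume "s \<in> ?R \<times> {..<n}" "t \<in> ?R \<times> {..<n}"
    then obtain a i b j where st: "s = (a, i)" "t = (b, j)" "a \<in> ?R" "b \<in> ?R" "i < n" "j < n"
      by (metis SigmaE lessThan_iff)
    have bL: "b \<in> left_class e" and aL: "a \<in> left_class e" using RL st by blast+
    show "?A \<one> s t = of_bool (s = t)"
    proof (cases "a = b")
      case True
      have "\<one> \<otimes> b = a \<otimes> e" using True L[OF bL] by simp
      then show ?thesis
        using induced_action_eq[OF e aL eN, of \<one> b \<rho> i j] \<rho>_one st True by simp
    next
      case False
      then have "\<one> \<otimes> b \<noteq> a \<otimes> g" if "g \<in> carrier ?N" for g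
        using orbit_representative_unique[OF e st(3,4)] orb that L[OF bL] by auto
      then show ?thesis
        using induced_action_eq_0[of e \<one> b a \<rho> i j] False st by simp
    qed
  next
    fix x y s t assume x: "x \<in> carrier G" and y: "y \<in> carrier G"
      and st': "s \<in> ?R \<times> {..<n}" "t \<in> ?R \<times> {..<n}"
    then obtain a i b j where st: "s = (a, i)" "t = (b, j)" "a \<in> ?R" "b \<in> ?R" "i < n" "j < n"
      by (metis SigmaE lessThan_iff)
    have bL: "b \<in> left_class e" and aL: "a \<in> left_class e" using RL st by blast+
    have bc: "b \<in> carrier G" "b \<otimes> e = b" using L[OF bL] by auto
    have ac: "a \<in> carrier G" using L[OF aL] by auto
    have ec: "e \<in> carrier G" using Nc[OF eN] .
    show "?A (x \<otimes> y) s t = (\<Sum>r\<in>?R \<times> {..<n}. ?A x s r * ?A y r t)"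
    proof (cases "y \<otimes> b \<in> left_class e")
      case True
      define c where "c = orbit_representative e (y \<otimes> b)"
      have cR: "c \<in> ?R" using True by (simp add: c_def)
      then have cL: "c \<in> left_class e" using RL by blast
      have cc: "c \<in> carrier G" using L[OF cL] by simp
      have "c \<in> right_orbit e (y \<otimes> b)"
        unfolding c_def by (rule orbit_representative_in_orbit[OF e True])
      then have "y \<otimes> b \<in> right_orbit e c"
        using right_orbit_eq[OF e True] right_orbit_self[OF e True] by blast
      then obtain h where h: "h \<in> carrier ?N" "y \<otimes> b = c \<otimes> h" using orb by blast
      \<comment> \<open>Only the block row \<open>c\<close> survives in column \<open>b\<close>, so
        the sum over the transversal collapses to one term.\<close>
      have Ay: "?A y (k, l) (b, j) = (if k = c then \<rho> h $$ (l, j) else 0)" if k: "k \<in> ?R" for k l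
      proof (cases "k = c")
        case True
        then show ?thesis using induced_action_eq[OF e cL h, of \<rho> l j] by simp
      next
        case False
        have kL: "k \<in> left_class e" using k RL by blast
        have "y \<otimes> b \<noteq> k \<otimes> g" if "g \<in> carrier ?N" for g
        proof
          assume "y \<otimes> b = k \<otimes> g"
          then have "y \<otimes> b \<in> right_orbit e k" using that orb by blast
          then have "right_orbit e (y \<otimes> b) = right_orbit e k" by (rule right_orbit_eq[OF e kL])
          then have "c \<in> right_orbit e k" using \<open>c \<in> right_orbit e (y \<otimes> b)\<close> by simp
          then show False using orbit_representative_unique[OF e k cR] False by simp
        qed
        then show ?thesis using induced_action_eq_0[of e y b k \<rho> l j] False by simp
      qed
      have "(\<Sum>r\<in>?R \<times> {..<n}. ?A x s r * ?A y r t) =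
          (\<Sum>k\<in>?R. \<Sum>l<n. ?A x s (k, l) * ?A y (k, l) (b, j))"
        unfolding st by (simp add: sum.cartesian_product)
      also have "\<dots> = (\<Sum>k\<in>?R. if k = c then \<Sum>l<n. ?A x s (c, l) * \<rho> h $$ (l, j) else 0)"
        by (intro sum.cong) (auto simp: Ay)
      also have "\<dots> = (\<Sum>l<n. ?A x s (c, l) * \<rho> h $$ (l, j))"
        using finR cR by simp
      also have "\<dots> = ?A (x \<otimes> y) s t"
      proof (cases "\<exists>g\<in>carrier ?N. x \<otimes> c = a \<otimes> g")
        case True
        then obtain g where g: "g \<in> carrier ?N" "x \<otimes> c = a \<otimes> g" by blast
        have gh: "g \<otimes> h \<in> carrier ?N" using N.m_closed[OF g(1) h(1)] by simp
        have "(x \<otimes> y) \<otimes> b = (x \<otimes> c) \<otimes> h" using x y bc cc Nc[OF h(1)] h(2) by (simp add: m_assoc)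
        also have "\<dots> = a \<otimes> (g \<otimes> h)" unfolding g(2) using ac Nc[OF g(1)] Nc[OF h(1)] by (simp add: m_assoc)
        finally have xyb: "(x \<otimes> y) \<otimes> b = a \<otimes> (g \<otimes> h)" .
        have "?A (x \<otimes> y) s t = (\<Sum>l<n. \<rho> g $$ (i, l) * \<rho> h $$ (l, j))"
          using induced_action_eq[OF e aL gh xyb, of \<rho> i j] \<rho>_mult[OF g(1) h(1) st(5,6)] st(1,2) by simp
        also have "\<dots> = (\<Sum>l<n. ?A x s (c, l) * \<rho> h $$ (l, j))"
          using induced_action_eq[OF e aL g, of \<rho> i] st(1) by simp
        finally show ?thesis by simp
      next
        case False
        let ?i = "inv\<^bsub>?N\<^esub> h"
        have i: "?i \<in> carrier ?N" "h \<otimes> ?i = e"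
          using N.inv_closed[OF h(1)] N.r_inv[OF h(1)] by auto
        \<comment> \<open>Otherwise multiplication by the inverse of \<open>h\<close> would bring
          \<open>x \<otimes> c\<close> into the orbit of \<open>a\<close>.\<close>
        have "(x \<otimes> y) \<otimes> b \<noteq> a \<otimes> g" if g: "g \<in> carrier ?N" for g
        proof
          assume eq: "(x \<otimes> y) \<otimes> b = a \<otimes> g"
          have "x \<otimes> c = x \<otimes> (c \<otimes> (h \<otimes> ?i))" using i L[OF cL] by simp
          also have "\<dots> = x \<otimes> ((c \<otimes> h) \<otimes> ?i)" using x cc Nc[OF h(1)] Nc[OF i(1)] by (simp add: m_assoc)
          also have "\<dots> = ((x \<otimes> y) \<otimes> b) \<otimes> ?i"
            unfolding h(2)[symmetric] using x y bc Nc[OF i(1)] by (simp add: m_assoc)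
          also have "\<dots> = a \<otimes> (g \<otimes> ?i)" unfolding eq using ac Nc[OF g] Nc[OF i(1)] by (simp add: m_assoc)
          finally have "x \<otimes> c = a \<otimes> (g \<otimes> ?i)" .
          moreover have "g \<otimes> ?i \<in> carrier ?N" using N.m_closed[OF g i(1)] by simp
          ultimately show False using False by blast
        qed
        then have "?A (x \<otimes> y) s t = 0"
          using induced_action_eq_0[of e "x \<otimes> y" b a \<rho> i j] st by simp
        moreover have "?A x s (c, l) = 0" for l
          using induced_action_eq_0[of e x c a \<rho> i l] False st by auto
        ultimately show ?thesis by simp
      qed
      finally show ?thesis by simp
    next
      case False
      have "?A y r t = 0" if r: "r \<in> ?R \<times> {..<n}" for r
      proof -
        obtain k l where kl: "r = (k, l)" "k \<in> left_class e" using r RL by auto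
        have "y \<otimes> b \<noteq> k \<otimes> g" if "g \<in> carrier ?N" for g
          using left_class_mult_right[OF e kl(2) that] False by metis
        then show ?thesis using induced_action_eq_0[of e y b k \<rho> l j] kl st by simp
      qed
      then have "(\<Sum>r\<in>?R \<times> {..<n}. ?A x s r * ?A y r t) = 0" by (intro sum.neutral) simp
      moreover have "(x \<otimes> y) \<otimes> b \<noteq> a \<otimes> g" if g: "g \<in> carrier ?N" for g
      proof
        assume "(x \<otimes> y) \<otimes> b = a \<otimes> g"
        then have "x \<otimes> (y \<otimes> b) \<in> left_class e"
          using left_class_mult_right[OF e aL g] x y bc by (simp add: m_assoc)
        moreover have "(y \<otimes> b) \<otimes> e = y \<otimes> b" using y bc ec by (simp add: m_assoc)
        ultimately show False using left_class_mult_leftD[OF e _ _ x] y bc False by blast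
      qed
      then have "?A (x \<otimes> y) s t = 0"
        using induced_action_eq_0[of e "x \<otimes> y" b a \<rho> i j] st by simp
      ultimately show ?thesis by simp
    qed
  qed
qed

text \<open>A nonzero diagonal block at \<open>a\<close> needs
  \<open>m \<otimes> a = a \<otimes> g\<close>. Cancelling \<open>a\<close> on the left and
  \<open>g\<close> on the right writes \<open>e\<close> as a multiple of \<open>m\<close>, which
  gives the vanishing. For \<open>m\<close> in the maximal subgroup only \<open>a = e\<close> is
  possible, and that block is \<open>\<rho> m\<close>.\<close>

lemma induced_character:
  fixes \<rho> :: "'a \<Rightarrow> 'k::field mat"
  assumes fin: "finite (carrier G)" and e: "e \<in> idempotents G"
    and \<rho>: "monoid_representation (maximal_subgroup G e) n \<rho>"
  obtains F where "virtual_character G F"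
    "\<forall>g\<in>carrier (maximal_subgroup G e). F g = mat_trace (\<rho> g)"
    "\<forall>m\<in>carrier G. (\<forall>a\<in>carrier G. \<forall>b\<in>carrier G. e \<noteq> a \<otimes> m \<otimes> b) \<longrightarrow> F m = 0"
proof -
  let ?N = "maximal_subgroup G e"
  let ?R = "orbit_representative e ` left_class e"
  let ?A = "induced_action e \<rho>"
  interpret N: group ?N by (rule maximal_subgroup_group[OF e])
  have ec: "e \<in> carrier G" "e \<otimes> e = e" using idempotentsD[OF e] by auto
  have eN: "e \<in> carrier ?N" using N.one_closed by simp
  have eL: "e \<in> left_class e" using ec by (auto simp: left_class_def)
  have NG: "g \<in> carrier G \<and> e \<otimes> g = g \<and> g \<otimes> e = g" if "g \<in> carrier ?N" for g
    using that unfolding maximal_subgroup_carrier_iff[OF e] by blast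
  have "orbit_representative e e = e"
    using right_orbit_self[OF e eL] by (simp add: orbit_representative_def)
  then have eR: "e \<in> ?R" using eL by (metis imageI)
  have RL: "?R \<subseteq> left_class e"
    using orbit_representative_in_orbit[OF e] right_orbit_subset[OF e] by blast
  have finR: "finite ?R" using fin by (auto simp: left_class_def)
  have n: "1 \<le> n" using \<rho> by (simp add: monoid_representation_def)
  have ne: "?R \<times> {..<n} \<noteq> {}" using eR n by (auto simp: lessThan_empty_iff)
  from matrix_action_representation[OF induced_matrix_action[OF fin e \<rho>] ne]
  obtain \<theta> where \<theta>: "monoid_representation G (card (?R \<times> {..<n})) \<theta>"
      "\<And>m. mat_trace (\<theta> m) = (\<Sum>s\<in>?R \<times> {..<n}. ?A m s s)"
    by blast
  have tr: "mat_trace (\<theta> m) = (\<Sum>a\<in>?R. \<Sum>i<n. ?A m (a, i) (a, i))" for m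
    unfolding \<theta>(2) by (simp add: sum.cartesian_product case_prod_unfold)
  have on_N: "mat_trace (\<theta> g) = mat_trace (\<rho> g)" if g: "g \<in> carrier ?N" for g
  proof -
    have zero: "?A g (a, i) (a, i) = 0" if a: "a \<in> ?R" "a \<noteq> e" for a i
    proof (rule induced_action_eq_0)
      fix h assume h: "h \<in> carrier ?N"
      have aL: "a \<in> left_class e" using a RL by blast
      then obtain y where y: "a \<in> carrier G" "a \<otimes> e = a" "y \<in> carrier G" "y \<otimes> a = e"
        by (auto simp: left_class_def)
      show "g \<otimes> a \<noteq> a \<otimes> h"
      proof
        assume eq: "g \<otimes> a = a \<otimes> h"
        let ?i = "inv\<^bsub>?N\<^esub> h"
        have i: "?i \<in> carrier ?N" "h \<otimes> ?i = e"
          using N.inv_closed[OF h] N.r_inv[OF h] by auto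
        \<comment> \<open>Written this way \<open>a\<close> starts with a group element, so
          \<open>e\<close> fixes it from the left too. It then lies in the maximal subgroup, whose
          only representative is \<open>e\<close>.\<close>
        have a_eq: "a = g \<otimes> a \<otimes> ?i"
          unfolding eq using y NG[OF h] NG[OF i(1)] i(2) by (simp add: m_assoc)
        have "e \<otimes> (g \<otimes> a \<otimes> ?i) = (e \<otimes> g) \<otimes> a \<otimes> ?i"
          using y(1) conjunct1[OF NG[OF g]] conjunct1[OF NG[OF i(1)]] ec(1) by (simp add: m_assoc)
        then have "e \<otimes> a = a" using a_eq NG[OF g] by simp
        then have aN: "a \<in> carrier ?N" using maximal_subgroup_leftI[OF fin e y(1) _ y(2,3,4)] by simp
        then have "a = e \<otimes> a" using NG by simp
        then have "a \<in> right_orbit e e" unfolding right_orbit_def using aN by blast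
        then show False using orbit_representative_unique[OF e eR a(1)] a(2) by simp
      qed
    qed
    have "mat_trace (\<theta> g) = (\<Sum>a\<in>?R. if a = e then \<Sum>i<n. ?A g (e, i) (e, i) else 0)"
      unfolding tr by (intro sum.cong) (auto simp: zero)
    also have "\<dots> = (\<Sum>i<n. ?A g (e, i) (e, i))" using finR eR by simp
    also have "\<dots> = (\<Sum>i<n. \<rho> g $$ (i, i))"
      using induced_action_eq[OF e eL g, of g e \<rho>] NG[OF g] by simp
    also have "\<dots> = mat_trace (\<rho> g)"
      using \<rho> g by (intro mat_trace_carrier[symmetric]) (auto simp: monoid_representation_def)
    finally show ?thesis .
  qed
  have off: "mat_trace (\<theta> m) = 0"
    if m: "m \<in> carrier G" and none: "\<And>a b. a \<in> carrier G \<Longrightarrow> b \<in> carrier G \<Longrightarrow> e \<noteq> a \<otimes> m \<otimes> b" for m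
  proof -
    have "?A m (a, i) (a, i) = 0" if a: "a \<in> ?R" for a i
    proof (rule induced_action_eq_0)
      fix g assume g: "g \<in> carrier ?N"
      obtain y where y: "a \<in> carrier G" "a \<otimes> e = a" "y \<in> carrier G" "y \<otimes> a = e"
        using a RL by (auto simp: left_class_def)
      show "m \<otimes> a \<noteq> a \<otimes> g"
      proof
        assume eq: "m \<otimes> a = a \<otimes> g"
        let ?i = "inv\<^bsub>?N\<^esub> g"
        have i: "?i \<in> carrier ?N" "g \<otimes> ?i = e"
          using N.inv_closed[OF g] N.r_inv[OF g] by auto
        have "y \<otimes> m \<otimes> (a \<otimes> ?i) = y \<otimes> (m \<otimes> a) \<otimes> ?i"
          using y m NG[OF i(1)] by (simp add: m_assoc)
        also have "\<dots> = (y \<otimes> a) \<otimes> (g \<otimes> ?i)"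
          unfolding eq using y(1,3) NG[OF g] NG[OF i(1)] by (simp add: m_assoc)
        also have "\<dots> = e" using y i ec by simp
        finally show False using none[of y "a \<otimes> ?i"] y NG[OF i(1)] by simp
      qed
    qed
    then show ?thesis unfolding tr by simp
  qed
  show thesis
  proof (rule that[of "character_of G \<theta>"])
    show "virtual_character G (character_of G \<theta>)"
      by (rule character_of_virtual[OF monoid_axioms \<theta>(1)])
    show "\<forall>g\<in>carrier ?N. character_of G \<theta> g = mat_trace (\<rho> g)"
      using on_N NG by (simp add: character_of_def)
    show "\<forall>m\<in>carrier G. (\<forall>a\<in>carrier G. \<forall>b\<in>carrier G. e \<noteq> a \<otimes> m \<otimes> b) \<longrightarrow> character_of G \<theta> m = 0"
      using off by (simp add: character_of_def)
  qed
qed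

text \<open>Prescribed values on the subgroup and vanishing elsewhere are preserved by sums and
  differences, so irreducible \<open>h\<close> suffice.\<close>

lemma induced_virtual_character:
  fixes h :: "'a \<Rightarrow> 'k::field"
  assumes fin: "finite (carrier G)" and e: "e \<in> idempotents G"
    and h: "virtual_character (maximal_subgroup G e) h"
  shows "\<exists>F. virtual_character G F \<and> (\<forall>g\<in>carrier (maximal_subgroup G e). F g = h g) \<and>
    (\<forall>m\<in>carrier G. (\<forall>a\<in>carrier G. \<forall>b\<in>carrier G. e \<noteq> a \<otimes> m \<otimes> b) \<longrightarrow> F m = 0)"
proof -
  have NG: "g \<in> carrier G" if "g \<in> carrier (maximal_subgroup G e)" for g
    using that unfolding maximal_subgroup_carrier_iff[OF e] by blast
  have irr: "\<exists>F. virtual_character G F \<and> (\<forall>g\<in>carrier (maximal_subgroup G e). F g = \<chi> g) \<and>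
      (\<forall>m\<in>carrier G. (\<forall>a\<in>carrier G. \<forall>b\<in>carrier G. e \<noteq> a \<otimes> m \<otimes> b) \<longrightarrow> F m = 0)"
    if \<chi>: "\<chi> \<in> irreducible_characters (maximal_subgroup G e)" for \<chi> :: "'a \<Rightarrow> 'k"
  proof -
    obtain n \<rho> where \<rho>: "monoid_representation (maximal_subgroup G e) n \<rho>"
        "\<chi> = character_of (maximal_subgroup G e) \<rho>"
      using irreducible_character_obtain[OF \<chi>] by metis
    obtain F where F: "virtual_character G F"
        "\<forall>g\<in>carrier (maximal_subgroup G e). F g = mat_trace (\<rho> g)"
        "\<forall>m\<in>carrier G. (\<forall>a\<in>carrier G. \<forall>b\<in>carrier G. e \<noteq> a \<otimes> m \<otimes> b) \<longrightarrow> F m = 0"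
      by (rule induced_character[OF fin e \<rho>(1)])
    have "\<forall>g\<in>carrier (maximal_subgroup G e). F g = \<chi> g"
      using F(2) by (simp add: \<rho>(2) character_of_def)
    then show ?thesis using F(1,3) by blast
  qed
  show ?thesis
    using h
  proof (induction rule: virtual_character_induct)
    case zero
    have "\<forall>g\<in>carrier (maximal_subgroup G e). (\<lambda>m\<in>carrier G. 0) g =
        (\<lambda>m\<in>carrier (maximal_subgroup G e). 0 :: 'k) g"
      using NG by simp
    moreover have "\<forall>m\<in>carrier G. (\<lambda>m\<in>carrier G. 0 :: 'k) m = 0" by simp
    ultimately show ?case using virtual_character_zero[of G] by blast
  next
    case (add f \<chi>)
    obtain F where F: "virtual_character G F" "\<forall>g\<in>carrier (maximal_subgroup G e). F g = f g"
        "\<forall>m\<in>carrier G. (\<forall>a\<in>carrier G. \<forall>b\<in>carrier G. e \<noteq> a \<otimes> m \<otimes> b) \<longrightarrow> F m = 0"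
      using add.IH by blast
    obtain F' where F': "virtual_character G F'" "\<forall>g\<in>carrier (maximal_subgroup G e). F' g = \<chi> g"
        "\<forall>m\<in>carrier G. (\<forall>a\<in>carrier G. \<forall>b\<in>carrier G. e \<noteq> a \<otimes> m \<otimes> b) \<longrightarrow> F' m = 0"
      using irr[OF \<open>\<chi> \<in> irreducible_characters (maximal_subgroup G e)\<close>] by blast
    let ?H = "\<lambda>m\<in>carrier G. F m + F' m"
    have "virtual_character G ?H" by (rule virtual_character_add[OF F(1) F'(1)])
    moreover have "\<forall>g\<in>carrier (maximal_subgroup G e). ?H g =
        (\<lambda>m\<in>carrier (maximal_subgroup G e). f m + \<chi> m) g"
      using F(2) F'(2) NG by simp
    moreover have "\<forall>m\<in>carrier G. (\<forall>a\<in>carrier G. \<forall>b\<in>carrier G. e \<noteq> a \<otimes> m \<otimes> b) \<longrightarrow> ?H m = 0"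
      using F(3) F'(3) by simp
    ultimately show ?case by blast
  next
    case (diff f \<chi>)
    obtain F where F: "virtual_character G F" "\<forall>g\<in>carrier (maximal_subgroup G e). F g = f g"
        "\<forall>m\<in>carrier G. (\<forall>a\<in>carrier G. \<forall>b\<in>carrier G. e \<noteq> a \<otimes> m \<otimes> b) \<longrightarrow> F m = 0"
      using diff.IH by blast
    obtain F' where F': "virtual_character G F'" "\<forall>g\<in>carrier (maximal_subgroup G e). F' g = \<chi> g"
        "\<forall>m\<in>carrier G. (\<forall>a\<in>carrier G. \<forall>b\<in>carrier G. e \<noteq> a \<otimes> m \<otimes> b) \<longrightarrow> F' m = 0"
      using irr[OF \<open>\<chi> \<in> irreducible_characters (maximal_subgroup G e)\<close>] by blast
    let ?H = "\<lambda>m\<in>carrier G. F m - F' m"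
    have "virtual_character G ?H" by (rule virtual_character_diff[OF F(1) F'(1)])
    moreover have "\<forall>g\<in>carrier (maximal_subgroup G e). ?H g =
        (\<lambda>m\<in>carrier (maximal_subgroup G e). f m - \<chi> m) g"
      using F(2) F'(2) NG by simp
    moreover have "\<forall>m\<in>carrier G. (\<forall>a\<in>carrier G. \<forall>b\<in>carrier G. e \<noteq> a \<otimes> m \<otimes> b) \<longrightarrow> ?H m = 0"
      using F(3) F'(3) by simp
    ultimately show ?case by blast
  qed
qed

subsection \<open>Restriction to the maximal subgroups\<close>

lemma maximal_subgroup_subset:
  "e \<in> idempotents G \<Longrightarrow> carrier (maximal_subgroup G e) \<subseteq> carrier G"
  using maximal_subgroup_carrier_iff by blast

text \<open>The inclusion preserves products but sends the unit of the subgroup to \<open>e\<close>,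
  hence the appeal to homomorphisms that need not be unital.\<close>

lemma virtual_character_restrict_to_subgroup:
  fixes f :: "'a \<Rightarrow> 'k::field"
  assumes e: "e \<in> idempotents G" and f: "virtual_character G f"
  shows "virtual_character (maximal_subgroup G e) (restrict_to_subgroup G e f)"
  unfolding restrict_to_subgroup_def
proof (rule virtual_character_semigroup_hom[OF monoid_axioms _ f])
  show "monoid (maximal_subgroup G e)"
    by (rule group.is_monoid[OF maximal_subgroup_group[OF e]])
qed (use maximal_subgroup_subset[OF e] in auto)

lemma virtual_character_omega_succ:
  fixes f :: "'a \<Rightarrow> 'k::field"
  assumes fin: "finite (carrier G)" and f: "virtual_character G f" and x: "x \<in> carrier G"
  shows "f (omega_succ G x) = f x"
proof -
  obtain k :: nat where k: "0 < k" "omega_power G x = x [^] k" "omega_power G x \<in> idempotents G"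
    by (rule omega_powerE[OF fin x])
  show ?thesis
    unfolding omega_succ_def
    using virtual_character_cyclic[OF monoid_axioms x k(1,2) idempotentsD(2)[OF k(3)] f] by blast
qed

text \<open>\<open>x\<close> and \<open>omega_succ G x\<close> have the same
  \<open>omega_power\<close> and the same \<open>omega_succ\<close>, hence the same
  \<open>p\<close>-prime part, to which each is equivalent.\<close>

lemma class_function_omega_succ:
  assumes fin: "finite (carrier G)" and f: "f \<in> class_functions G p \<xi>" and x: "x \<in> carrier G"
  shows "f (omega_succ G x) = f x"
proof -
  have "f y = f (omega_succ_p_prime G p y)" if "y \<in> carrier G" for y
    by (rule class_functionD[OF f char_equiv.p_prime[OF that]])
  moreover have "omega_succ_p_prime G p (omega_succ G x) = omega_succ_p_prime G p x"
    unfolding omega_succ_p_prime_def omega_cyclic_group_def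
    by (simp only: omega_power_omega_succ[OF fin x] omega_succ_omega_succ[OF fin x])
  ultimately show ?thesis using x omega_succ_closed[OF fin x] by metis
qed

text \<open>Ideals are ranked by cardinality, a linear refinement of inclusion. When an idempotent
  is treated, the ideals of those treated before are no larger, so a correction induced from it
  leaves their subgroups untouched.\<close>

lemma virtual_character_with_restrictions:
  fixes h :: "nat \<Rightarrow> 'a \<Rightarrow> 'k::field"
  assumes fin: "finite (carrier G)" and reps: "D_class_representatives G es"
    and h: "\<And>i. i < length es \<Longrightarrow> virtual_character (maximal_subgroup G (es ! i)) (h i)"
  obtains F where "virtual_character G F"
    "\<forall>i<length es. restrict_to_subgroup G (es ! i) F = h i"
proof -
  define ideal where "ideal e = (\<lambda>(a, b). a \<otimes> e \<otimes> b) ` (carrier G \<times> carrier G)" for e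
  have fin_ideal: "finite (ideal e)" for e using fin by (simp add: ideal_def)
  have idem: "es ! i \<in> idempotents G" if "i < length es" for i
    using reps that unfolding D_class_representatives_def by (meson nth_mem subsetD)
  have "S \<subseteq> {..<length es} \<longrightarrow>
      (\<exists>F. virtual_character G F \<and>
        (\<forall>i\<in>S. \<forall>g\<in>carrier (maximal_subgroup G (es ! i)). F g = h i g))"
    if "finite S" for S
    using that
  proof (induction rule: finite_ranking_induct[where f = "\<lambda>i. card (ideal (es ! i))"])
    case empty
    then show ?case using virtual_character_zero by blast
  next
    case (insert x S)
    show ?case
    proof (intro impI)
      assume sub: "insert x S \<subseteq> {..<length es}"
      then have xl: "x < length es" by simp
      obtain F where F: "virtual_character G F"
          "\<forall>i\<in>S. \<forall>g\<in>carrier (maximal_subgroup G (es ! i)). F g = h i g"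
        using insert.IH sub by blast
      let ?e = "es ! x"
      have e: "?e \<in> idempotents G" by (rule idem[OF xl])
      \<comment> \<open>The defect at the new idempotent; inducing it and adding the result to
        \<open>F\<close> corrects the restriction there.\<close>
      have "virtual_character (maximal_subgroup G ?e)
          (\<lambda>g\<in>carrier (maximal_subgroup G ?e). h x g - restrict_to_subgroup G ?e F g)"
        by (rule virtual_character_diff[OF h[OF xl] virtual_character_restrict_to_subgroup[OF e F(1)]])
      from induced_virtual_character[OF fin e this]
      obtain F' where F': "virtual_character G F'"
          "\<forall>g\<in>carrier (maximal_subgroup G ?e). F' g =
            (\<lambda>g\<in>carrier (maximal_subgroup G ?e). h x g - restrict_to_subgroup G ?e F g) g"
          "\<forall>m\<in>carrier G. (\<forall>a\<in>carrier G. \<forall>b\<in>carrier G. ?e \<noteq> a \<otimes> m \<otimes> b) \<longrightarrow> F' m = 0"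
        by blast
      let ?H = "\<lambda>m\<in>carrier G. F m + F' m"
      have "?H g = h i g"
        if i: "i \<in> insert x S" and g: "g \<in> carrier (maximal_subgroup G (es ! i))" for i g
      proof (cases "i = x")
        case True
        have "g \<in> carrier G" using g maximal_subgroup_subset[OF e] True by blast
        then show ?thesis using F'(2) g True by (simp add: restrict_to_subgroup_def)
      next
        case False
        then have iS: "i \<in> S" using i by simp
        then have il: "i < length es" using sub by auto
        let ?f = "es ! i"
        have f: "?f \<in> idempotents G" by (rule idem[OF il])
        have gc: "g \<in> carrier G" "?f \<otimes> g = g"
          using g unfolding maximal_subgroup_carrier_iff[OF f] by auto
        have ec: "?e \<in> carrier G" and fc: "?f \<in> carrier G" using idempotentsD e f by auto
        have "?e \<noteq> a \<otimes> g \<otimes> b" if ab: "a \<in> carrier G" "b \<in> carrier G" for a b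
        proof
          assume "?e = a \<otimes> g \<otimes> b"
          \<comment> \<open>As \<open>?f\<close> fixes \<open>g\<close>, a factorization of
            \<open>?e\<close> through \<open>g\<close> is one through \<open>?f\<close>.\<close>
          then have ef: "?e = a \<otimes> ?f \<otimes> (g \<otimes> b)"
            using gc ab fc by (metis m_assoc m_closed)
          have gb: "g \<otimes> b \<in> carrier G" using gc ab by simp
          have "ideal ?e \<subseteq> ideal ?f"
          proof
            fix z assume "z \<in> ideal ?e"
            then obtain c d where cd: "c \<in> carrier G" "d \<in> carrier G" "z = c \<otimes> ?e \<otimes> d"
              by (auto simp: ideal_def)
            have "z = (c \<otimes> a) \<otimes> ?f \<otimes> ((g \<otimes> b) \<otimes> d)"
              unfolding cd(3) ef using cd(1,2) ab(1) gb fc by (simp add: m_assoc)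
            then show "z \<in> ideal ?f"
              unfolding ideal_def using cd ab(1) gb by (intro image_eqI[of _ _ "(c \<otimes> a, (g \<otimes> b) \<otimes> d)"]) auto
          qed
          \<comment> \<open>The ranking turns the inclusion of ideals into equality, hence into
            \<open>D\<close>-equivalence. Two positions would then represent the class of
            \<open>?f\<close>.\<close>
          moreover have "card (ideal ?f) \<le> card (ideal ?e)" by (rule insert.hyps(2)[OF iS])
          ultimately have "ideal ?e = ideal ?f" using fin_ideal card_seteq by blast
          moreover have "?f \<in> ideal ?f"
            unfolding ideal_def using fc by (intro image_eqI[of _ _ "(\<one>, \<one>)"]) auto
          ultimately have "?f \<in> ideal ?e" by simp
          then obtain c d where "c \<in> carrier G" "d \<in> carrier G" "?f = c \<otimes> ?e \<otimes> d"
            by (auto simp: ideal_def)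
          then have "D_equivalent G ?e ?f"
            by (rule finite_J_imp_D_equivalent[OF fin e f ab(1) gb ef])
          then show False
            using reps f xl il False D_equivalent_refl[OF f] unfolding D_class_representatives_def by blast
        qed
        then have "F' g = 0" using F'(3) gc(1) by blast
        then show ?thesis using F(2) iS g gc(1) by simp
      qed
      then show "\<exists>F. virtual_character G F \<and>
          (\<forall>i\<in>insert x S. \<forall>g\<in>carrier (maximal_subgroup G (es ! i)). F g = h i g)"
        using virtual_character_add[OF F(1) F'(1)] by blast
    qed
  qed
  from this[of "{..<length es}"] obtain F where F: "virtual_character G F"
      "\<forall>i\<in>{..<length es}. \<forall>g\<in>carrier (maximal_subgroup G (es ! i)). F g = h i g"
    by auto
  have "restrict_to_subgroup G (es ! i) F = h i" if i: "i < length es" for i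
    by (rule virtual_character_eqI[OF virtual_character_restrict_to_subgroup[OF idem[OF i] F(1)] h[OF i]])
      (use F(2) i in \<open>simp add: restrict_to_subgroup_def\<close>)
  then show thesis using that F(1) by blast
qed

lemma restrict_to_subgroup_ring_hom:
  assumes e: "e \<in> idempotents G"
  shows "restrict_to_subgroup G e \<in> Ring.ring_hom (virtual_character_ring G :: ('a \<Rightarrow> 'k::field) ring)
    (virtual_character_ring (maximal_subgroup G e))"
proof (rule ring_hom_memI)
  fix f assume "f \<in> carrier (virtual_character_ring G :: ('a \<Rightarrow> 'k) ring)"
  then show "restrict_to_subgroup G e f \<in> carrier (virtual_character_ring (maximal_subgroup G e))"
    using virtual_character_restrict_to_subgroup[OF e, of f] by simp
qed (use maximal_subgroup_subset[OF e] in
    \<open>auto simp: restrict_to_subgroup_def fun_eq_iff restrict_def\<close>)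

end

text \<open>\<open>ring_iso\<close> speaks of a bijection respecting the operations;
  \<open>ring_hom_ring\<close> adds that both structures are rings.\<close>

theorem theorem3p2:
  fixes M :: "('a, 'b) monoid_scheme"
    and p :: nat
    and \<xi> :: "'k::field alg_closure"
    and es :: "'a list"
  assumes "monoid M"
    and "finite (carrier M)"
    and "CHAR('k) = p"
    and "primitive_root_of_unity (regular_exponent M p) \<xi>"
    and "D_class_representatives M es"
  defines "\<Phi> \<equiv> \<lambda>f :: 'a \<Rightarrow> 'k. map (\<lambda>e. restrict_to_subgroup M e f) es"
    and "Ch_M \<equiv> virtual_character_ring M :: ('a \<Rightarrow> 'k) ring"
    and "Ch_prod \<equiv> RDirProd_list
           (map (\<lambda>e. virtual_character_ring (maximal_subgroup M e) :: ('a \<Rightarrow> 'k) ring) es)"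
  shows "(\<forall>f \<in> class_functions M p \<xi>.
            virtual_character M f \<longleftrightarrow>
            (\<forall>e\<in>set es. virtual_character (maximal_subgroup M e) (restrict_to_subgroup M e f)))
       \<and> ring_hom_ring Ch_M Ch_prod \<Phi>
       \<and> \<Phi> \<in> ring_iso Ch_M Ch_prod"
proof -
  interpret monoid M by (rule assms(1))
  note fin = assms(2) and reps = assms(5)
  have idem: "e \<in> idempotents M" if "e \<in> set es" for e
    using reps that unfolding D_class_representatives_def by blast
  have virtual_comm: "\<And>x y. x \<in> carrier M \<Longrightarrow> y \<in> carrier M \<Longrightarrow> f (x \<otimes>\<^bsub>M\<^esub> y) = f (y \<otimes>\<^bsub>M\<^esub> x)"
    if "virtual_character M f" for f :: "'a \<Rightarrow> 'k"
    by (rule virtual_character_comm[OF assms(1) that])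
  have "virtual_character M f"
    if f: "f \<in> class_functions M p \<xi>"
      and loc: "\<forall>e\<in>set es. virtual_character (maximal_subgroup M e) (restrict_to_subgroup M e f)" for f
  proof -
    obtain F where F: "virtual_character M F"
        "\<forall>i<length es. restrict_to_subgroup M (es ! i) F = restrict_to_subgroup M (es ! i) f"
      using virtual_character_with_restrictions[OF fin reps, of "\<lambda>i. restrict_to_subgroup M (es ! i) f"]
        loc nth_mem by metis
    \<comment> \<open>\<open>F\<close> is built from the restrictions of \<open>f\<close>. Both are
      invariant under swapping factors and under \<open>omega_succ\<close>, so agreement on the
      chosen subgroups spreads to all of \<open>M\<close>.\<close>
    have "f x = F x" if x: "x \<in> carrier M" for x
    proof (rule trace_like_eqI[where f = f and g = F, OF fin reps])
      fix x y assume xy: "x \<in> carrier M" "y \<in> carrier M"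
      show "f (x \<otimes>\<^bsub>M\<^esub> y) = f (y \<otimes>\<^bsub>M\<^esub> x)"
        by (rule class_functionD[OF f char_equiv.swap[OF xy]])
      show "F (x \<otimes>\<^bsub>M\<^esub> y) = F (y \<otimes>\<^bsub>M\<^esub> x)" by (rule virtual_comm[OF F(1) xy])
    next
      fix x assume x: "x \<in> carrier M"
      show "f (omega_succ M x) = f x" by (rule class_function_omega_succ[OF fin f x])
      show "F (omega_succ M x) = F x" by (rule virtual_character_omega_succ[OF fin F(1) x])
    next
      fix e x assume e: "e \<in> set es" and x: "x \<in> carrier (maximal_subgroup M e)"
      obtain i where "i < length es" "es ! i = e" using e by (metis in_set_conv_nth)
      then have "restrict_to_subgroup M e F x = restrict_to_subgroup M e f x" using F(2) by metis
      then show "f x = F x" using x by (simp add: restrict_to_subgroup_def)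
    qed (rule x)
    then have "(\<lambda>x\<in>carrier M. f x) = (\<lambda>x\<in>carrier M. F x)" by (intro restrict_ext)
    moreover have "(\<lambda>x\<in>carrier M. f x) = f"
      using f unfolding class_functions_def by (blast intro: PiE_restrict)
    ultimately show ?thesis using F(1) virtual_character_extensional[OF F(1)] by simp
  qed
  then have part1: "\<forall>f \<in> class_functions M p \<xi>. virtual_character M f \<longleftrightarrow>
      (\<forall>e\<in>set es. virtual_character (maximal_subgroup M e) (restrict_to_subgroup M e f))"
    using virtual_character_restrict_to_subgroup idem by blast
  have hom: "\<Phi> \<in> Ring.ring_hom Ch_M Ch_prod"
    unfolding \<Phi>_def Ch_M_def Ch_prod_def
    by (rule ring_hom_RDirProd_list) (rule restrict_to_subgroup_ring_hom[OF idem])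
  have ring_M: "ring Ch_M" unfolding Ch_M_def by (rule virtual_character_ring_ring[OF assms(1)])
  have "ring (virtual_character_ring (maximal_subgroup M e) :: ('a \<Rightarrow> 'k) ring)" if "e \<in> set es" for e
    by (rule virtual_character_ring_ring[OF group.is_monoid[OF maximal_subgroup_group[OF idem[OF that]]]])
  then have ring_prod: "ring Ch_prod"
    unfolding Ch_prod_def by (intro RDirProd_list_is_ring) simp
  have inj: "inj_on \<Phi> (carrier Ch_M)"
  proof (rule inj_onI)
    fix f g assume "f \<in> carrier Ch_M" "g \<in> carrier Ch_M" and eq: "\<Phi> f = \<Phi> g"
    then have f: "virtual_character M f" and g: "virtual_character M g" by (simp_all add: Ch_M_def)
    show "f = g"
    proof (rule virtual_character_eqI[OF f g])
      fix x assume x: "x \<in> carrier M"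
      show "f x = g x"
      \<comment> \<open>Injectivity is the same determination by restrictions, applied to two
        virtual characters.\<close>
      proof (rule trace_like_eqI[OF fin reps virtual_comm[OF f] virtual_comm[OF g]
            virtual_character_omega_succ[OF fin f] virtual_character_omega_succ[OF fin g] _ x])
        fix e x assume e: "e \<in> set es" and x: "x \<in> carrier (maximal_subgroup M e)"
        have "restrict_to_subgroup M e f = restrict_to_subgroup M e g"
          using eq e by (simp add: \<Phi>_def)
        then have "restrict_to_subgroup M e f x = restrict_to_subgroup M e g x" by (rule fun_cong)
        then show "f x = g x" using x by (simp add: restrict_to_subgroup_def)
      qed
    qed
  qed
  have surj: "\<Phi> ` carrier Ch_M = carrier Ch_prod"
  proof (intro equalityI subsetI)
    fix hs assume "hs \<in> \<Phi> ` carrier Ch_M"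
    then show "hs \<in> carrier Ch_prod" using ring_hom_closed[OF hom] by blast
  next
    fix hs assume hs: "hs \<in> carrier Ch_prod"
    have len: "length hs = length es"
      using RDirProd_list_carrier_mem(1)[OF hs[unfolded Ch_prod_def]] by simp
    have virt: "virtual_character (maximal_subgroup M (es ! i)) (hs ! i)" if "i < length es" for i
      using RDirProd_list_carrier_mem(2)[OF hs[unfolded Ch_prod_def], of i] that by simp
    obtain F where F: "virtual_character M F"
        "\<forall>i<length es. restrict_to_subgroup M (es ! i) F = hs ! i"
      by (rule virtual_character_with_restrictions[OF fin reps virt])
    have "\<Phi> F = hs" unfolding \<Phi>_def using F(2) len by (intro nth_equalityI) auto
    moreover have "F \<in> carrier Ch_M" using F(1) by (simp add: Ch_M_def)
    ultimately show "hs \<in> \<Phi> ` carrier Ch_M" by blast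
  qed
  have "\<Phi> \<in> ring_iso Ch_M Ch_prod" using hom inj surj by (simp add: ring_iso_def bij_betw_def)
  moreover have "ring_hom_ring Ch_M Ch_prod \<Phi>" by (rule ring_hom_ringI2[OF ring_M ring_prod hom])
  ultimately show ?thesis using part1 by blast
qed

end
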